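(* Assume the following. (i) $\lambda_{\max}(V(\theta_0))\le\overline\lambda_V<\infty$ for some $\overline\lambda_V>0$. (ii) There is a function $\mathcal L:\mathcal Z\times\Theta\to\mathbb R$ such that $\theta\mapsto\mathcal L(\cdot,\theta)$ is convex and differentiable and $\psi(\cdot,\theta)=\nabla_\theta\mathcal L(\cdot,\theta)$; and there exist $\delta_0>0$ and a non-decreasing function $\underline\mu:(0,\delta_0)\to\mathbb R^+$ with $\underline\mu(\delta)\le\inf_{\eta\in\mathbb S^{d-1}}\eta^\top\mu(\theta_0+\delta\eta)$ for all $\delta\in(0,\delta_0)$. (iii) For $n\ge1$ there is $u_{1,n}:\mathbb R^+\times(0,1)\to\mathbb R^+$ such that for all $\delta\in(0,\delta_0)$ and $\varepsilon\in(0,1)$, $$\mathbb P^*\Big(\sqrt{n/2}\sup_{\eta\in\mathbb S^{d-1}}-\eta^\top\big(\bar\psi_1(\theta_0+\delta\eta)-\mu(\theta_0+\delta\eta)-\bar\psi_1(\theta_0)\big)\ge u_{1,n}(\delta;\varepsilon)\Big)\le\varepsilon .$$ Then for every $q>2$ there exists a constant $C=C(q)>0$ such that the following holds: for any $\varepsilon\in(0,1)$, if $r_n=r_n(\varepsilon)$ satisfies $0<r_n<\delta_0$ and $$\underline\mu(r_n)>\frac{u_{1,n}(r_n;\varepsilon)}{\sqrt n}+C\,\overline\lambda_V\left[\sqrt{\frac{d+\log(2/\varepsilon)}{n}}+\frac{L_q\,d^{1/2}}{n^{1-1/q}\varepsilon^{1/q}}\right],$$ then $\mathbb P(\|\wi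dehat\theta_1-\theta_0\|_2>r_n)\le2\varepsilon$.
   Context: $Z,Z_1,\dots,Z_n$ are i.i.d. from $P$ on a sample space $\mathcal Z$; $\Theta\subseteq\mathbb R^d$; $\psi:\mathcal Z\times\Theta\to\mathbb R^d$ is measurable; $\theta_0$ is the solution in $\Theta$ of $\mathbb E[\psi(Z,\theta)]=0_d$. $n$ is even, $[n]$ is partitioned into $\mathcal I_1,\mathcal I_2$ of sizes $n_1=n_2=n/2$. $\mu(\theta)=\mathbb E[\psi(Z,\theta)]$, $V(\theta)=\mathrm{Var}(\psi(Z,\theta))$, $\bar\psi_1(\theta)=n_1^{-1}\sum_{i\in\mathcal I_1}\psi(Z_i,\theta)$. $\widehat\theta_1$ is the $Z$-estimator from $\mathcal D_1=\{Z_i:i\in\mathcal I_1\}$, i.e. $\bar\psi_1(\widehat\theta_1)=0_d$. $\mathbb S^{d-1}$ is the unit sphere of $\mathbb R^d$; $\mathbb P^*$ denotes outer probability. $L_q=\sup_{u\in\mathbb S^{d-1}}\dfrac{(\mathbb E|u^\top\psi(Z,\theta_0)|^q)^{1/q}}{(\mathbb E|u^\top\psi(Z,\theta_0)|^2)^{1/2}}$.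
   Formalization: The condition on r_n uses u_{1,n}(r_n;ε)/√(n/2) instead of u_{1,n}(r_n;ε)/√n, and C may depend on λ̄_V as well as q (formally C is also chosen per carrier type of the sample and outcome spaces); as printed the claim fails by a factor √2 and under rescaling of ψ. *)

theory Defs
  imports "HOL-Probability.Probability"
begin

text \<open>
  The constant of the theorem must not depend on the dimension, so the dimension \<open>d\<close> is a
  natural number and \<open>\<real>\<^sup>d\<close> is the carrier of the product \<open>\<Pi>\<^sub>M i\<in>{..<d}. borel\<close>, i.e. the set of
  extensional functions on \<open>{..<d}\<close>.
\<close>

type_synonym rvec = "nat \<Rightarrow> real"

definition Rn :: "nat \<Rightarrow> rvec set" where
  "Rn d = (\<Pi>\<^sub>E i\<in>{..<d}. UNIV)"

definition borel_n :: "nat \<Rightarrow> rvec measure" where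
  "borel_n d = (\<Pi>\<^sub>M i\<in>{..<d}. borel)"

definition inner_n :: "nat \<Rightarrow> rvec \<Rightarrow> rvec \<Rightarrow> real" where
  "inner_n d x y = (\<Sum>i<d. x i * y i)"

definition norm_n :: "nat \<Rightarrow> rvec \<Rightarrow> real" where
  "norm_n d x = sqrt (\<Sum>i<d. (x i)\<^sup>2)"

definition dist_n :: "nat \<Rightarrow> rvec \<Rightarrow> rvec \<Rightarrow> real" where
  "dist_n d x y = norm_n d (\<lambda>i. x i - y i)"

definition sphere_n :: "nat \<Rightarrow> rvec set" where
  "sphere_n d = {u \<in> Rn d. norm_n d u = 1}"

text \<open>The points \<open>x + t v\<close> and \<open>(1 - t) x + t y\<close> as elements of \<open>Rn d\<close>.\<close>

definition shift_n :: "nat \<Rightarrow> rvec \<Rightarrow> real \<Rightarrow> rvec \<Rightarrow> rvec" where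
  "shift_n d x t v = (\<lambda>i\<in>{..<d}. x i + t * v i)"

definition segment_n :: "nat \<Rightarrow> rvec \<Rightarrow> rvec \<Rightarrow> real \<Rightarrow> rvec" where
  "segment_n d x y t = (\<lambda>i\<in>{..<d}. (1 - t) * x i + t * y i)"

text \<open>As for the library's \<open>convex_on\<close>, convexity of a function includes convexity of its domain.\<close>

definition convex_fun_n :: "nat \<Rightarrow> rvec set \<Rightarrow> (rvec \<Rightarrow> real) \<Rightarrow> bool" where
  "convex_fun_n d S f \<longleftrightarrow>
     (\<forall>x\<in>S. \<forall>y\<in>S. \<forall>t\<in>{0..1}.
        segment_n d x y t \<in> S \<and> f (segment_n d x y t) \<le> (1 - t) * f x + t * f y)"

text \<open>\<open>g\<close> is the Frechet gradient at \<open>x\<close> of \<open>f\<close> restricted to \<open>S\<close>.\<close>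

definition has_gradient_n :: "nat \<Rightarrow> rvec set \<Rightarrow> (rvec \<Rightarrow> real) \<Rightarrow> rvec \<Rightarrow> rvec \<Rightarrow> bool" where
  "has_gradient_n d S f g x \<longleftrightarrow>
     (\<forall>e>0. \<exists>s>0. \<forall>y\<in>S. dist_n d y x < s \<longrightarrow>
        \<bar>f y - f x - inner_n d g (\<lambda>i. y i - x i)\<bar> \<le> e * dist_n d y x)"

definition eigenvalues_n :: "nat \<Rightarrow> (nat \<Rightarrow> nat \<Rightarrow> real) \<Rightarrow> real set" where
  "eigenvalues_n d A =
     {l. \<exists>v\<in>Rn d. (\<exists>i<d. v i \<noteq> 0) \<and> (\<forall>i<d. (\<Sum>j<d. A i j * v j) = l * v i)}"

text \<open>Only meant for symmetric \<open>A\<close> and \<open>d > 0\<close>: then the set is finite and nonempty.\<close>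

definition lambda_max :: "nat \<Rightarrow> (nat \<Rightarrow> nat \<Rightarrow> real) \<Rightarrow> real" where
  "lambda_max d A = Max (eigenvalues_n d A)"

definition mean_psi :: "'z measure \<Rightarrow> ('z \<Rightarrow> rvec \<Rightarrow> rvec) \<Rightarrow> rvec \<Rightarrow> rvec" where
  "mean_psi P \<psi> \<theta> = (\<lambda>i. \<integral>z. \<psi> z \<theta> i \<partial>P)"

definition cov_psi :: "'z measure \<Rightarrow> ('z \<Rightarrow> rvec \<Rightarrow> rvec) \<Rightarrow> rvec \<Rightarrow> nat \<Rightarrow> nat \<Rightarrow> real" where
  "cov_psi P \<psi> \<theta> i j =
     (\<integral>z. (\<psi> z \<theta> i - mean_psi P \<psi> \<theta> i) * (\<psi> z \<theta> j - mean_psi P \<psi> \<theta> j) \<partial>P)"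

text \<open>The average of \<open>\<psi>(D\<^sub>i, \<theta>)\<close> over the data points \<open>D\<^sub>i\<close>, \<open>i \<in> I\<close>.\<close>

definition avg_psi :: "('z \<Rightarrow> rvec \<Rightarrow> rvec) \<Rightarrow> nat set \<Rightarrow> (nat \<Rightarrow> 'z) \<Rightarrow> rvec \<Rightarrow> rvec" where
  "avg_psi \<psi> I D \<theta> = (\<lambda>j. (\<Sum>i\<in>I. \<psi> (D i) \<theta> j) / real (card I))"

text \<open>
  Extended-real valued, since \<open>L\<^sub>q\<close> is infinite when some \<open>q\<close>-th moment is, whereas the Bochner
  integral of a non-integrable function is \<open>0\<close>.
\<close>

definition Lp_norm :: "'z measure \<Rightarrow> real \<Rightarrow> ('z \<Rightarrow> real) \<Rightarrow> ereal" where
  "Lp_norm P p f =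
     (if integrable P (\<lambda>z. \<bar>f z\<bar> powr p) then ereal ((\<integral>z. \<bar>f z\<bar> powr p \<partial>P) powr (1 / p)) else \<infinity>)"

text \<open>
  Directions \<open>u\<close> with \<open>u\<^sup>T\<psi>(Z, \<theta>) = 0\<close> almost surely contribute \<open>0\<close> to the supremum, because
  \<open>0 / 0 = 0\<close> in \<^typ>\<open>ereal\<close>.
\<close>

definition L_ratio ::
  "nat \<Rightarrow> 'z measure \<Rightarrow> ('z \<Rightarrow> rvec \<Rightarrow> rvec) \<Rightarrow> rvec \<Rightarrow> real \<Rightarrow> ereal" where
  "L_ratio d P \<psi> \<theta> q =
     (SUP u\<in>sphere_n d.
        Lp_norm P q (\<lambda>z. inner_n d u (\<psi> z \<theta>)) / Lp_norm P 2 (\<lambda>z. inner_n d u (\<psi> z \<theta>)))"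

text \<open>
  \<open>P\<close> is the law on the sample space, \<open>M\<close> the probability space carrying the sample, and the
  estimator \<open>T\<close> is a measurable function of the data with indices in \<open>I\<^sub>1\<close>.
\<close>

locale split_Z_estimation =
  fixes d n :: nat and P :: "'z measure" and \<Theta> :: "rvec set"
    and \<psi> :: "'z \<Rightarrow> rvec \<Rightarrow> rvec" and \<theta>\<^sub>0 :: rvec
    and M :: "'w measure" and Z :: "nat \<Rightarrow> 'w \<Rightarrow> 'z"
    and I\<^sub>1 I\<^sub>2 :: "nat set" and T :: "(nat \<Rightarrow> 'z) \<Rightarrow> rvec"
  assumes dim_pos: "d > 0"
    and prob_P: "prob_space P"
    and prob_M: "prob_space M"
    and indep_Z: "prob_space.indep_vars M (\<lambda>_. P) Z {1..n}"
    and distr_Z: "\<And>i. i \<in> {1..n} \<Longrightarrow> distr M P (Z i) = P"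
    and n_pos: "n > 0" and n_even: "even n"
    and partition: "I\<^sub>1 \<union> I\<^sub>2 = {1..n}" "I\<^sub>1 \<inter> I\<^sub>2 = {}" "card I\<^sub>1 = n div 2" "card I\<^sub>2 = n div 2"
    and Theta_sub: "\<Theta> \<subseteq> Rn d"
    and psi_measurable:
      "(\<lambda>(z, \<theta>). \<psi> z \<theta>) \<in> measurable (P \<Otimes>\<^sub>M restrict_space (borel_n d) \<Theta>) (borel_n d)"
    and psi_integrable: "\<And>\<theta> i. \<theta> \<in> \<Theta> \<Longrightarrow> i < d \<Longrightarrow> integrable P (\<lambda>z. \<psi> z \<theta> i)"
    and psi_square_integrable: "\<And>i. i < d \<Longrightarrow> integrable P (\<lambda>z. (\<psi> z \<theta>\<^sub>0 i)\<^sup>2)"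
    and theta0_in: "\<theta>\<^sub>0 \<in> \<Theta>"
    and theta0_solves: "\<And>i. i < d \<Longrightarrow> mean_psi P \<psi> \<theta>\<^sub>0 i = 0"
    and theta0_unique: "\<And>\<theta>. \<theta> \<in> \<Theta> \<Longrightarrow> (\<And>i. i < d \<Longrightarrow> mean_psi P \<psi> \<theta> i = 0) \<Longrightarrow> \<theta> = \<theta>\<^sub>0"
    and T_measurable: "T \<in> measurable (\<Pi>\<^sub>M i\<in>I\<^sub>1. P) (borel_n d)"
    and T_in: "\<And>D. D \<in> space (\<Pi>\<^sub>M i\<in>I\<^sub>1. P) \<Longrightarrow> T D \<in> \<Theta>"
    and T_solves:
      "\<And>D j. D \<in> space (\<Pi>\<^sub>M i\<in>I\<^sub>1. P) \<Longrightarrow> j < d \<Longrightarrow> avg_psi \<psi> I\<^sub>1 D (T D) j = 0"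

text \<open>The subsample \<open>\<D>\<^sub>1\<close> at the outcome \<open>\<omega>\<close>.\<close>

definition subsample :: "(nat \<Rightarrow> 'w \<Rightarrow> 'z) \<Rightarrow> nat set \<Rightarrow> 'w \<Rightarrow> nat \<Rightarrow> 'z" where
  "subsample Z I \<omega> = (\<lambda>i\<in>I. Z i \<omega>)"

end

theory Submission
  imports Defs
begin

text \<open>
  By convexity the empirical score is monotone along rays from \<open>\<theta>\<^sub>0\<close>, so an estimator further than \<open>r\<close>
  from \<open>\<theta>\<^sub>0\<close> forces \<open>\<eta>\<^sup>T\<psi>\<^sub>1(\<theta>\<^sub>0 + r\<eta>) \<le> 0\<close> for some unit vector \<open>\<eta>\<close>, where \<open>\<psi>\<^sub>1\<close> is the average
  score. Hence either the localized process exceeds \<open>u\<close>, or the norm of the average score at \<open>\<theta>\<^sub>0\<close> exceeds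
  the second term of the radius condition.

  The latter is excluded by a Fuk--Nagaev inequality with the weak variance \<open>\<lambda>\<close> in front of
  \<open>ln (2 / \<epsilon>)\<close>. For \<open>f(S) = sqrt (R\<^sup>2 + |S|\<^sup>2)\<close> one has
  \<open>f(S + Y) \<le> f(S) + v\<^sup>TY + |Y|\<^sup>2 / (2R)\<close> with \<open>|v| \<le> 1\<close>. The exponential moments of \<open>f(S)\<close> over truncated summands
  therefore grow, up to a remainder controlled by the \<open>q\<close>-th moment, by
  \<open>exp (A (s\<^sup>2\<lambda> + s d\<lambda> / R))\<close> per summand, and \<open>R\<close> of order \<open>sqrt (N d \<lambda>)\<close>
  balances the linear term. No covering of the sphere is needed, so the heavy-tailed term keeps the
  factor \<open>sqrt d\<close>.
\<close>

section \<open>Euclidean norms in coordinates and scalar bounds for truncated exponentials\<close>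

lemma norm_n_nonneg [simp]: "0 \<le> norm_n d x"
  by (simp add: norm_n_def sum_nonneg)

lemma norm_n_square: "(norm_n d x)\<^sup>2 = (\<Sum>i<d. (x i)\<^sup>2)"
  by (simp add: norm_n_def sum_nonneg)

lemma inner_n_self: "inner_n d x x = (norm_n d x)\<^sup>2"
  unfolding norm_n_square by (simp add: inner_n_def power2_eq_square)

lemma inner_n_le_norm: "\<bar>inner_n d x y\<bar> \<le> norm_n d x * norm_n d y"
proof -
  have "\<bar>inner_n d x y\<bar> \<le> (\<Sum>i<d. \<bar>x i\<bar> * \<bar>y i\<bar>)"
    unfolding inner_n_def by (rule order.trans[OF sum_abs]) (simp add: abs_mult)
  also have "\<dots> \<le> L2_set x {..<d} * L2_set y {..<d}"
    by (rule L2_set_mult_ineq)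
  finally show ?thesis
    by (simp add: norm_n_def L2_set_def)
qed

text \<open>Lagrange remainder of order two. With \<open>c = q\<close> the quadratic coefficient
  depends on \<open>q\<close> only.\<close>

lemma exp_le_quadratic:
  fixes w c :: real
  assumes "\<bar>w\<bar> \<le> c"
  shows "exp w \<le> 1 + w + exp c * w\<^sup>2"
proof -
  obtain t where t: "\<bar>t\<bar> \<le> \<bar>w\<bar>" "exp w = (\<Sum>m<2. w ^ m / fact m) + exp t / fact 2 * w\<^sup>2"
    using Maclaurin_exp_le[of w 2] by blast
  have "exp t / 2 \<le> exp t" by simp
  also have "\<dots> \<le> exp c" using t(1) assms by simp
  finally have "exp t / 2 * w\<^sup>2 \<le> exp c * w\<^sup>2"
    by (rule mult_right_mono) simp
  with t(2) show ?thesis by (simp add: numeral_2_eq_2)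
qed

text \<open>The quotient \<open>exp y / y powr q\<close> is nondecreasing for
  \<open>y \<ge> q\<close>. An exponential beyond level \<open>q\<close> can thus be paid for by a
  \<open>q\<close>-th moment, with a factor \<open>exp Y\<close> taken at the truncation
  level.\<close>

lemma exp_le_powr_mult_exp:
  fixes q y Y :: real
  assumes "0 < q" "q \<le> y" "y \<le> Y"
  shows "exp y \<le> (y / Y) powr q * exp Y"
proof -
  have pos: "0 < y" "0 < Y" using assms by auto
  have "q * ln (Y / y) \<le> q * (Y / y - 1)"
    using assms pos by (intro mult_left_mono ln_le_minus_one) auto
  also have "\<dots> = (q / y) * (Y - y)" using pos by (simp add: field_simps)
  also have "\<dots> \<le> 1 * (Y - y)"
    using assms pos by (intro mult_right_mono) auto
  also have "ln (Y / y) = - ln (y / Y)" using pos by (simp add: ln_div)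
  finally have "y \<le> q * ln (y / Y) + Y" by simp
  then have "exp y \<le> exp (q * ln (y / Y) + Y)" by simp
  also have "\<dots> = (y / Y) powr q * exp Y"
    using pos by (simp add: powr_def exp_add)
  finally show ?thesis .
qed

text \<open>Here \<open>a\<close> stands for the first-order increment of the smoothed norm and
  \<open>b\<close> for its curvature term, both times \<open>s\<close>. Small \<open>y\<close> is
  handled by Taylor expansion, larger \<open>y\<close> below \<open>B\<close> by the power bound.
  The right-hand side carries no indicator, so its linear term can later be integrated to zero by
  centring.\<close>

lemma truncated_exp_bound:
  fixes a s y B R q :: real
  assumes q: "1 \<le> q" and s: "0 < s" and y: "0 \<le> y" and B: "0 < B" "B \<le> R"
    and a: "\<bar>a\<bar> \<le> s * y"
  defines "b \<equiv> s * y\<^sup>2 / (2 * R)"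
  shows "exp (a + b) * indicator {..B} y
     \<le> 1 + a + (1 + 2 * q * exp q) * b + 2 * exp q * a\<^sup>2 + 3 * exp (3 / 2 * s * B) * (y / B) powr q"
    (is "_ \<le> ?rhs")
proof -
  define W where "W = 3 / 2 * s * B"
  \<comment> \<open>\<open>w\<close> dominates \<open>\<bar>a + b\<bar>\<close> below the truncation
    level, because \<open>y \<le> B \<le> R\<close> bounds \<open>b\<close> by
    \<open>s * y / 2\<close>. \<open>W\<close> is the value of \<open>w\<close> at
    \<open>y = B\<close>.\<close>
  define w where "w = 3 / 2 * s * y"
  have R: "0 < R" using B by simp
  have b0: "0 \<le> b" using s R by (simp add: b_def)
  have p0: "0 \<le> exp W * (y / B) powr q" by simp
  have q0: "0 \<le> 2 * q * exp q * b" using q b0 by simp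
  have a0: "0 \<le> 2 * exp q * a\<^sup>2" by simp
  have rhs: "?rhs = 1 + a + b + 2 * q * exp q * b + 2 * exp q * a\<^sup>2 + 3 * (exp W * (y / B) powr q)"
    by (simp add: W_def algebra_simps)
  show ?thesis
  proof (cases "y \<le> B")
    case True
    have "s * y * y \<le> s * y * R"
      using True B s y by (intro mult_left_mono) auto
    then have bw: "b \<le> s * y / 2"
      using R by (simp add: b_def field_simps power2_eq_square)
    have "w = s * y + s * y / 2" "0 \<le> s * y" using s y by (auto simp: w_def)
    then have abw: "\<bar>a + b\<bar> \<le> w" "b \<le> w" "- a \<le> w" using a b0 bw by linarith+
    show ?thesis
    proof (cases "w \<le> q")
      case True
      have "exp (a + b) \<le> 1 + (a + b) + exp q * (a + b)\<^sup>2"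
        using abw True by (intro exp_le_quadratic) auto
      also have "exp q * (a + b)\<^sup>2 \<le> exp q * (2 * a\<^sup>2 + 2 * (q * b))"
      proof (intro mult_left_mono)
        have "(a + b)\<^sup>2 \<le> 2 * a\<^sup>2 + 2 * (b * b)"
          using sum_squares_bound[of a b] by (simp add: power2_eq_square algebra_simps)
        also have "b * b \<le> q * b" using abw True b0 by (intro mult_right_mono) auto
        finally show "(a + b)\<^sup>2 \<le> 2 * a\<^sup>2 + 2 * (q * b)" by simp
      qed simp
      also have "1 + (a + b) + exp q * (2 * a\<^sup>2 + 2 * (q * b)) \<le> ?rhs"
        unfolding rhs using p0 by (simp add: algebra_simps)
      finally show ?thesis using \<open>y \<le> B\<close> by simp
    next
      case False
      have ww: "w / W = y / B" using s by (simp add: w_def W_def)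
      have "exp w \<le> (w / W) powr q * exp W"
        using False q \<open>y \<le> B\<close> s by (intro exp_le_powr_mult_exp) (auto simp: w_def W_def)
      then have ew: "exp w \<le> exp W * (y / B) powr q" unfolding ww by (simp add: mult.commute)
      have "exp (a + b) \<le> exp w" using abw by simp
      moreover have "- a \<le> exp w" using abw(3) exp_ge_add_one_self[of w] by linarith
      ultimately have "exp (a + b) \<le> ?rhs"
        unfolding rhs using ew q0 a0 b0 p0 by linarith
      then show ?thesis using \<open>y \<le> B\<close> by simp
    qed
  next
    case False
    \<comment> \<open>Beyond \<open>B\<close> the left side vanishes, but \<open>1 + a\<close> may
      be negative, so the power term has to outweigh \<open>s * y\<close>.\<close>
    have "(y / B) powr 1 \<le> (y / B) powr q"
      using False B q by (intro powr_mono) auto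
    then have 1: "y / B \<le> (y / B) powr q" using False B by simp
    have 2: "s * B \<le> exp W"
    proof -
      have "0 < s * B" "W = 3 / 2 * (s * B)" using s B by (simp_all add: W_def)
      then show ?thesis using exp_ge_add_one_self[of W] by linarith
    qed
    have "s * y = s * B * (y / B)" using B by simp
    also have "\<dots> \<le> exp W * (y / B) powr q"
      using 1 2 y B by (intro mult_mono) auto
    finally have "0 \<le> ?rhs"
      unfolding rhs using a b0 q0 a0 p0 by linarith
    then show ?thesis using False by simp
  qed
qed

text \<open>Concavity of the square root; in the Hilbert norm this replaces a second-order expansion of
  a smoothed norm, whose curvature is at most \<open>1 / R\<close>.\<close>

lemma smoothed_norm_add_le:
  fixes d :: nat and R :: real and x y :: rvec
  assumes "0 < R"
  defines "f \<equiv> \<lambda>x. sqrt (R\<^sup>2 + (norm_n d x)\<^sup>2)"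
  shows "f (\<lambda>i. x i + y i) \<le> f x + inner_n d x y / f x + (norm_n d y)\<^sup>2 / (2 * R)"
proof -
  have fR: "R \<le> f x" "0 < f x" using assms
    by (auto simp: f_def intro!: real_le_rsqrt add_pos_nonneg)
  have fsq: "(f z)\<^sup>2 = R\<^sup>2 + (norm_n d z)\<^sup>2" for z by (simp add: f_def)
  \<comment> \<open>\<open>c\<close> is the increment of the linearised root:
    \<open>(f x + c)\<^sup>2\<close> exceeds the square of the new value by
    \<open>c\<^sup>2\<close>.\<close>
  define c where "c = (2 * inner_n d x y + (norm_n d y)\<^sup>2) / (2 * f x)"
  have fc: "2 * f x * c = 2 * inner_n d x y + (norm_n d y)\<^sup>2"
    using fR by (simp add: c_def)
  have "(norm_n d (\<lambda>i. x i + y i))\<^sup>2 = (norm_n d x)\<^sup>2 + 2 * inner_n d x y + (norm_n d y)\<^sup>2"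
    by (simp add: norm_n_square inner_n_def power2_sum sum.distrib sum_distrib_left algebra_simps)
  then have sq: "(f (\<lambda>i. x i + y i))\<^sup>2 = (f x)\<^sup>2 + 2 * f x * c"
    using fsq fc by simp
  also have "\<dots> \<le> (f x + c)\<^sup>2" by (simp add: power2_sum)
  finally have "\<bar>f (\<lambda>i. x i + y i)\<bar> \<le> \<bar>f x + c\<bar>" by (simp add: abs_le_square_iff)
  \<comment> \<open>This removes the absolute value: the square of the new value is nonnegative,
    which forces \<open>c \<ge> - f x / 2\<close>.\<close>
  moreover have "0 \<le> f x + c"
  proof -
    have "0 \<le> (f x)\<^sup>2 + 2 * f x * c" using sq[symmetric] by simp
    then have "0 \<le> f x * (f x + 2 * c)" by (simp add: power2_eq_square algebra_simps)
    then have "0 \<le> f x + 2 * c" using fR by (simp add: zero_le_mult_iff)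
    then show ?thesis using fR by linarith
  qed
  moreover have "c \<le> inner_n d x y / f x + (norm_n d y)\<^sup>2 / (2 * R)"
  proof -
    have "(norm_n d y)\<^sup>2 / (2 * f x) \<le> (norm_n d y)\<^sup>2 / (2 * R)"
      using fR assms by (intro divide_left_mono) auto
    then show ?thesis by (simp add: c_def add_divide_distrib)
  qed
  ultimately show ?thesis by linarith
qed

subsection \<open>Rayleigh quotients\<close>

text \<open>Distinct eigenvalues have orthogonal eigenvectors; Bessel's inequality for the standard basis
  vectors, summed over the \<open>d\<close> coordinates, leaves room for at most \<open>d\<close> of them.\<close>

lemma finite_eigenvalues_n:
  assumes sym: "\<And>i j. i < d \<Longrightarrow> j < d \<Longrightarrow> A i j = A j i"
  shows "finite (eigenvalues_n d A)"
proof (rule ccontr)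
  assume "infinite (eigenvalues_n d A)"
  then obtain E where E: "E \<subseteq> eigenvalues_n d A" "finite E" "card E = Suc d"
    using infinite_arbitrarily_large by blast
  have "\<exists>v. norm_n d v = 1 \<and> (\<forall>i<d. (\<Sum>j<d. A i j * v j) = l * v i)" if l: "l \<in> E" for l
  proof -
    obtain v where v: "\<exists>i<d. v i \<noteq> 0" "\<forall>i<d. (\<Sum>j<d. A i j * v j) = l * v i"
      using subsetD[OF E(1) l] unfolding eigenvalues_n_def by blast
    have "0 < (\<Sum>i<d. (v i)\<^sup>2)"
      using v(1) by (auto simp: sum_nonneg_eq_0_iff order.strict_iff_order intro!: sum_nonneg)
    then have pos: "0 < norm_n d v" by (simp add: norm_n_def)
    have "norm_n d (\<lambda>i. v i / norm_n d v) = norm_n d v / norm_n d v"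
      by (subst (1) norm_n_def)
        (simp add: power_divide sum_divide_distrib[symmetric] norm_n_square[symmetric])
    moreover have "\<forall>i<d. (\<Sum>j<d. A i j * (v j / norm_n d v)) = l * (v i / norm_n d v)"
      using v(2) by (simp add: sum_divide_distrib[symmetric])
    ultimately show ?thesis using pos by (intro exI[of _ "\<lambda>i. v i / norm_n d v"]) simp
  qed
  then obtain v where v: "\<And>l. l \<in> E \<Longrightarrow> norm_n d (v l) = 1"
    "\<And>l i. l \<in> E \<Longrightarrow> i < d \<Longrightarrow> (\<Sum>j<d. A i j * v l j) = l * v l i"
    by metis
  have orth: "inner_n d (v l) (v k) = (if l = k then 1 else 0)" if "l \<in> E" "k \<in> E" for l k
  proof (cases "l = k")
    case True
    then show ?thesis using v(1)[OF that(1)] by (simp add: inner_n_self)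
  next
    case False
    \<comment> \<open>Symmetry moves \<open>A\<close> across the inner product, so distinct
      eigenvalues force the product to vanish.\<close>
    have "l * inner_n d (v l) (v k) = (\<Sum>i<d. (\<Sum>j<d. A i j * v l j) * v k i)"
      using v(2)[OF that(1)] by (simp add: inner_n_def sum_distrib_left mult.assoc)
    also have "\<dots> = (\<Sum>i<d. \<Sum>j<d. A i j * v l j * v k i)"
      by (simp add: sum_distrib_right)
    also have "\<dots> = (\<Sum>j<d. \<Sum>i<d. A i j * v l j * v k i)" by (rule sum.swap)
    also have "\<dots> = (\<Sum>j<d. \<Sum>i<d. A j i * v k i * v l j)"
      by (intro sum.cong refl) (simp add: sym mult_ac)
    also have "\<dots> = (\<Sum>j<d. (\<Sum>i<d. A j i * v k i) * v l j)"
      by (simp add: sum_distrib_right)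
    also have "\<dots> = k * inner_n d (v l) (v k)"
      using v(2)[OF that(2)] by (simp add: inner_n_def sum_distrib_left mult_ac)
    finally show ?thesis using False by simp
  qed
  have bessel: "(\<Sum>l\<in>E. (v l i)\<^sup>2) \<le> 1" if i: "i < d" for i
  proof -
    define e where "e = (\<lambda>j. if j = i then 1 else 0 :: real)"
    \<comment> \<open>\<open>g\<close> is the orthogonal projection of the basis vector
      \<open>e\<close> onto the span of the eigenvectors.\<close>
    define g where "g = (\<lambda>j. \<Sum>l\<in>E. v l i * v l j)"
    have ee: "inner_n d e e = 1" and eg: "inner_n d e g = (\<Sum>l\<in>E. (v l i)\<^sup>2)"
      using i by (simp_all add: inner_n_def e_def g_def power2_eq_square if_distrib[of "\<lambda>x. x * _"] cong: if_cong)
    have "inner_n d g g = (\<Sum>j<d. \<Sum>l\<in>E. \<Sum>k\<in>E. v l i * v k i * (v l j * v k j))"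
      by (simp add: inner_n_def g_def sum_product mult_ac)
    also have "\<dots> = (\<Sum>l\<in>E. \<Sum>j<d. \<Sum>k\<in>E. v l i * v k i * (v l j * v k j))"
      by (rule sum.swap)
    also have "\<dots> = (\<Sum>l\<in>E. \<Sum>k\<in>E. \<Sum>j<d. v l i * v k i * (v l j * v k j))"
      by (intro sum.cong refl sum.swap)
    also have "\<dots> = (\<Sum>l\<in>E. \<Sum>k\<in>E. v l i * v k i * inner_n d (v l) (v k))"
      by (simp add: inner_n_def sum_distrib_left)
    also have "\<dots> = (\<Sum>l\<in>E. (v l i)\<^sup>2)"
      using E(2) by (simp add: orth power2_eq_square if_distrib[of "\<lambda>x. _ * x"] cong: if_cong)
    finally have gg: "inner_n d g g = (\<Sum>l\<in>E. (v l i)\<^sup>2)" .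
    have "0 \<le> (\<Sum>j<d. (e j - g j)\<^sup>2)" by (simp add: sum_nonneg)
    also have "\<dots> = inner_n d e e - 2 * inner_n d e g + inner_n d g g"
      by (simp add: inner_n_def algebra_simps power2_eq_square sum.distrib sum_subtractf sum_distrib_left)
    finally show ?thesis using ee eg gg by simp
  qed
  \<comment> \<open>Counting the squared entries by vectors gives \<open>d + 1\<close>, by
    coordinates at most \<open>d\<close>.\<close>
  have "real (Suc d) = (\<Sum>l\<in>E. (norm_n d (v l))\<^sup>2)" using E v(1) by simp
  also have "\<dots> = (\<Sum>i<d. \<Sum>l\<in>E. (v l i)\<^sup>2)"
    unfolding norm_n_square by (rule sum.swap)
  also have "\<dots> \<le> (\<Sum>i<d. 1)" by (intro sum_mono bessel) simp
  finally show False by simp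
qed

text \<open>The first-order condition at a maximum: for small \<open>t\<close> the linear term
  governs the sign. The witness \<open>t\<close> has the sign of \<open>c\<close> and is small
  relative to \<open>1 / \<bar>e\<bar>\<close>.\<close>

lemma quadratic_nonpos_imp_zero:
  fixes c e :: real
  assumes "\<And>t. 2 * t * c + t\<^sup>2 * e \<le> 0"
  shows "c = 0"
proof (rule ccontr)
  assume c: "c \<noteq> 0"
  define t where "t = c / (1 + \<bar>e\<bar>)"
  have te: "c = t * (1 + \<bar>e\<bar>)" by (simp add: t_def add_nonneg_eq_0_iff)
  have t: "0 < t\<^sup>2" using c by (auto simp: t_def add_nonneg_eq_0_iff)
  have "2 * t * c + t\<^sup>2 * e = t\<^sup>2 * (2 + 2 * \<bar>e\<bar> + e)"
    unfolding te by (simp add: power2_eq_square algebra_simps)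
  moreover have "0 < 2 + 2 * \<bar>e\<bar> + e" by linarith
  ultimately show False using assms[of t] t by (simp add: mult_le_0_iff)
qed

text \<open>Extension by zero places the sphere in a product of compact intervals and singletons.
  Tychonoff's theorem then gives the compactness by which the Rayleigh quotient attains its
  maximum.\<close>

lemma compact_unit_sphere_zero_extended:
  "compact {v :: nat \<Rightarrow> real. (\<forall>i\<ge>d. v i = 0) \<and> (\<Sum>i<d. (v i)\<^sup>2) = 1}" (is "compact ?K")
proof -
  let ?box = "PiE UNIV (\<lambda>i. if i < d then {-1..1} else {0 :: real})"
  have "compactin (product_topology (\<lambda>i. euclidean) UNIV) ?box"
    unfolding compactin_PiE by (auto simp: compactin_euclidean_iff)
  then have box: "compact ?box"
    by (simp only: euclidean_product_topology compactin_euclidean_iff)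
  have "closed {v :: nat \<Rightarrow> real. (\<Sum>i<d. (v i)\<^sup>2) = 1}"
    by (intro closed_Collect_eq continuous_intros continuous_on_product_coordinates)
  then have "compact (?box \<inter> {v. (\<Sum>i<d. (v i)\<^sup>2) = 1})"
    by (rule compact_Int_closed[OF box])
  also have "?box \<inter> {v. (\<Sum>i<d. (v i)\<^sup>2) = 1} = ?K"
  proof -
    have "\<bar>v i\<bar> \<le> 1" if "(\<Sum>i<d. (v i)\<^sup>2) = 1" "i < d" for v :: "nat \<Rightarrow> real" and i
    proof -
      have "(v i)\<^sup>2 \<le> (\<Sum>i<d. (v i)\<^sup>2)"
        using that by (intro member_le_sum) auto
      with that show ?thesis by (simp add: abs_square_le_1)
    qed
    then have "v \<in> ?box" if "v \<in> ?K" for v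
      using that by (force simp: PiE_iff abs_le_iff)
    moreover have "v \<in> ?K" if "v \<in> ?box" "(\<Sum>i<d. (v i)\<^sup>2) = 1" for v
    proof -
      have "v i = 0" if "d \<le> i" for i
        using PiE_mem[OF \<open>v \<in> ?box\<close>, of i] that by simp
      with that show ?thesis by simp
    qed
    ultimately show ?thesis by blast
  qed
  finally show ?thesis .
qed

text \<open>A maximizer of the Rayleigh quotient is an eigenvector.\<close>

lemma quadratic_form_le_lambda_max:
  assumes d: "0 < d" and sym: "\<And>i j. i < d \<Longrightarrow> j < d \<Longrightarrow> A i j = A j i"
  shows "(\<Sum>i<d. \<Sum>j<d. A i j * w i * w j) \<le> lambda_max d A * (norm_n d w)\<^sup>2"
proof -
  define a where "a x y = (\<Sum>i<d. \<Sum>j<d. A i j * x i * y j)" for x y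
  define K where "K = {v :: nat \<Rightarrow> real. (\<forall>i\<ge>d. v i = 0) \<and> (\<Sum>i<d. (v i)\<^sup>2) = 1}"
  have "(\<lambda>i. if i = 0 then 1 else 0) \<in> K"
    using d by (auto simp: K_def if_distrib[of "\<lambda>x. x\<^sup>2"] cong: if_cong)
  then have "K \<noteq> {}" by blast
  moreover have "continuous_on K (\<lambda>v. a v v)"
    unfolding a_def by (intro continuous_intros continuous_on_subset[OF continuous_on_product_coordinates]) auto
  ultimately obtain v where v: "v \<in> K" "\<And>y. y \<in> K \<Longrightarrow> a y y \<le> a v v"
    using continuous_attains_sup[of K "\<lambda>v. a v v"] compact_unit_sphere_zero_extended[of d]
    by (auto simp: K_def)
  define l where "l = a v v"
  have norm_v: "inner_n d v v = 1" using v(1) by (simp add: K_def inner_n_def power2_eq_square)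
  have le: "a y y \<le> l * inner_n d y y" for y
  proof (cases "norm_n d y = 0")
    case True
    then have "\<forall>i<d. y i = 0"
      by (simp add: norm_n_def sum_nonneg_eq_0_iff)
    then show ?thesis using True by (simp add: a_def inner_n_self)
  next
    case False
    define z where "z = (\<lambda>i. if i < d then y i / norm_n d y else 0)"
    have "(\<Sum>i<d. (z i)\<^sup>2) = 1"
      using False by (simp add: z_def power_divide sum_divide_distrib[symmetric] norm_n_square[symmetric])
    then have "z \<in> K" by (simp add: K_def z_def)
    then have "a z z \<le> l" using v(2) by (simp add: l_def)
    also have "a z z = a y y / (norm_n d y)\<^sup>2"
      by (simp add: a_def z_def sum_divide_distrib power2_eq_square)
    finally show ?thesis using False by (simp add: inner_n_self divide_le_eq)
  qed
  have a_sym: "a x y = a y x" for x y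
  proof -
    have "a x y = (\<Sum>j<d. \<Sum>i<d. A i j * x i * y j)" unfolding a_def by (rule sum.swap)
    also have "\<dots> = a y x" unfolding a_def by (intro sum.cong refl) (simp add: sym mult_ac)
    finally show ?thesis .
  qed
  \<comment> \<open>The residual \<open>A v - l v\<close>. Perturbing the maximizer in this
    direction turns the first-order condition into a vanishing squared norm.\<close>
  define y where "y = (\<lambda>i. (\<Sum>j<d. A i j * v j) - l * v i)"
  have a_vy: "a v y = a y v" by (rule a_sym)
  have "a y v = (\<Sum>i<d. y i * (\<Sum>j<d. A i j * v j))"
    by (simp add: a_def sum_distrib_left mult_ac)
  also have "\<dots> = (\<Sum>i<d. y i * (y i + l * v i))" by (simp add: y_def)
  finally have "a y v - l * inner_n d v y = inner_n d y y"
    by (simp add: inner_n_def algebra_simps sum.distrib sum_distrib_left)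
  moreover have "a y v - l * inner_n d v y = 0"
  proof (rule quadratic_nonpos_imp_zero)
    fix t :: real
    let ?z = "\<lambda>i. v i + t * y i"
    have "a ?z ?z = a v v + t * a v y + t * a y v + t\<^sup>2 * a y y"
      by (simp add: a_def algebra_simps sum.distrib sum_distrib_left power2_eq_square)
    moreover have "inner_n d ?z ?z = inner_n d v v + 2 * t * inner_n d v y + t\<^sup>2 * inner_n d y y"
      by (simp add: inner_n_def algebra_simps sum.distrib sum_distrib_left power2_eq_square)
    ultimately show "2 * t * (a y v - l * inner_n d v y) + t\<^sup>2 * (a y y - l * inner_n d y y) \<le> 0"
      using le[of ?z] by (simp add: a_vy norm_v l_def[symmetric] algebra_simps)
  qed
  ultimately have "(\<Sum>i<d. (y i)\<^sup>2) = 0" by (simp add: inner_n_def power2_eq_square)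
  then have eig: "(\<Sum>j<d. A i j * v j) = l * v i" if "i < d" for i
    using that by (simp add: sum_nonneg_eq_0_iff y_def)
  have "\<exists>i<d. v i \<noteq> 0"
  proof (rule ccontr)
    assume "\<not> (\<exists>i<d. v i \<noteq> 0)"
    then have "inner_n d v v = 0" by (simp add: inner_n_def)
    with norm_v show False by simp
  qed
  \<comment> \<open>The maximizer is zero outside \<open>{..<d}\<close>, whereas \<open>Rn d\<close>
    consists of extensional functions.\<close>
  moreover have "restrict v {..<d} \<in> Rn d" by (simp add: Rn_def restrict_PiE_iff)
  ultimately have "l \<in> eigenvalues_n d A"
    unfolding eigenvalues_n_def using eig by (intro CollectI bexI[of _ "restrict v {..<d}"]) auto
  then have "l \<le> lambda_max d A"
    unfolding lambda_max_def using finite_eigenvalues_n[of d A] sym by (intro Max_ge) auto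
  then have "l * inner_n d w w \<le> lambda_max d A * inner_n d w w"
    by (intro mult_right_mono) (auto simp: inner_n_self)
  then show ?thesis
    using le[of w] by (simp add: a_def inner_n_self)
qed

subsection \<open>A Fuk--Nagaev inequality in Euclidean norm\<close>

text \<open>\<open>lam\<close> bounds the variance in each direction and \<open>m\<close> the
  \<open>q\<close>-th moment of the norm. The trace costs \<open>d * lam\<close> and is derived
  below, so that the two kinds of variance enter the exponent separately.\<close>

locale centred_vector = prob_space P for P :: "'z measure" +
  fixes d :: nat and X :: "'z \<Rightarrow> rvec" and lam q m :: real
  assumes X_measurable: "\<And>j. j < d \<Longrightarrow> (\<lambda>z. X z j) \<in> borel_measurable P"
    and square_integrable: "\<And>j. j < d \<Longrightarrow> integrable P (\<lambda>z. (X z j)\<^sup>2)"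
    and mean_zero: "\<And>j. j < d \<Longrightarrow> (\<integral>z. X z j \<partial>P) = 0"
    and weak_variance: "\<And>v. norm_n d v \<le> 1 \<Longrightarrow> (\<integral>z. (inner_n d v (X z))\<^sup>2 \<partial>P) \<le> lam"
    and q_ge_1: "1 \<le> q"
    and powr_integrable: "integrable P (\<lambda>z. norm_n d (X z) powr q)"
    and powr_moment: "(\<integral>z. norm_n d (X z) powr q \<partial>P) \<le> m"
begin

lemma norm_measurable [measurable]: "(\<lambda>z. norm_n d (X z)) \<in> borel_measurable P"
  unfolding norm_n_def using X_measurable by measurable

lemma inner_measurable [measurable]: "(\<lambda>z. inner_n d v (X z)) \<in> borel_measurable P"
  unfolding inner_n_def using X_measurable by measurable

lemma coordinate_integrable: "j < d \<Longrightarrow> integrable P (\<lambda>z. X z j)"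
  using square_integrable_imp_integrable[OF X_measurable square_integrable] .

lemma inner_integrable: "integrable P (\<lambda>z. inner_n d v (X z))"
  unfolding inner_n_def using coordinate_integrable by auto

lemma inner_mean_zero: "(\<integral>z. inner_n d v (X z) \<partial>P) = 0"
  unfolding inner_n_def using coordinate_integrable mean_zero by simp

lemma norm_square_integrable: "integrable P (\<lambda>z. (norm_n d (X z))\<^sup>2)"
  unfolding norm_n_square using square_integrable by auto

lemma inner_square_integrable: "integrable P (\<lambda>z. (inner_n d v (X z))\<^sup>2)"
proof (rule Bochner_Integration.integrable_bound)
  show "integrable P (\<lambda>z. (norm_n d v)\<^sup>2 * (norm_n d (X z))\<^sup>2)"
    using norm_square_integrable by simp
  show "AE z in P. norm ((inner_n d v (X z))\<^sup>2) \<le> norm ((norm_n d v)\<^sup>2 * (norm_n d (X z))\<^sup>2)"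
    using inner_n_le_norm[of d v]
    by (intro AE_I2) (simp add: power_mult_distrib[symmetric] abs_le_square_iff[symmetric])
qed measurable

text \<open>Testing the weak variance against the standard basis vectors and adding up bounds the
  trace of the covariance.\<close>

lemma norm_square_expectation: "(\<integral>z. (norm_n d (X z))\<^sup>2 \<partial>P) \<le> real d * lam"
proof -
  have "(\<integral>z. (X z j)\<^sup>2 \<partial>P) \<le> lam" if "j < d" for j
  proof -
    have sum1: "(\<Sum>i<d. (if i = j then 1 else 0) * g i) = g j" for g :: "nat \<Rightarrow> real"
      using that by (simp add: if_distrib[of "\<lambda>x. x * _"] cong: if_cong)
    show ?thesis
      using weak_variance[of "\<lambda>i. if i = j then 1 else 0"] sum1 sum1[of "\<lambda>_. 1"]
      by (simp add: inner_n_def norm_n_def if_distrib[of "\<lambda>x. x\<^sup>2"] cong: if_cong)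
  qed
  then have "(\<Sum>j<d. \<integral>z. (X z j)\<^sup>2 \<partial>P) \<le> (\<Sum>j<d. lam)"
    by (intro sum_mono) auto
  then show ?thesis
    using square_integrable by (simp add: norm_n_square)
qed

lemma moment_nonneg: "0 \<le> m"
  by (rule order.trans[OF _ powr_moment]) (rule Bochner_Integration.integral_nonneg, simp)

text \<open>The growth factor of the exponential moment per summand. The three exponents come from
  the curvature of the smoothed norm, the variance along its gradient, and the truncated
  tail.\<close>

definition step_bound :: "real \<Rightarrow> real \<Rightarrow> real \<Rightarrow> real" where
  "step_bound s B R = exp ((1 + 2 * q * exp q) * s * (real d * lam) / (2 * R) + 2 * exp q * s\<^sup>2 * lam
     + 3 * exp (3 / 2 * s * B) * m / B powr q)"

text \<open>Truncation calls for no recentring: the majorant \<open>G\<close> holds on the whole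
  space, so its linear term integrates to zero, and \<open>1 + x \<le> exp x\<close> puts the rest
  in exponential form.\<close>

lemma nn_integral_step_le:
  assumes v: "norm_n d v \<le> 1" and s: "0 < s" and B: "0 < B" "B \<le> R"
  shows "(\<integral>\<^sup>+z. ennreal (exp (s * (inner_n d v (X z) + (norm_n d (X z))\<^sup>2 / (2 * R)))
             * indicator {..B} (norm_n d (X z))) \<partial>P) \<le> ennreal (step_bound s B R)"
proof -
  define A where "A = 1 + 2 * q * exp q"
  define G where "G z = 1 + s * inner_n d v (X z) + A * (s * (norm_n d (X z))\<^sup>2 / (2 * R))
     + 2 * exp q * (s * inner_n d v (X z))\<^sup>2
     + 3 * exp (3 / 2 * s * B) * (norm_n d (X z) / B) powr q" for z
  have A: "0 \<le> A" using q_ge_1 by (simp add: A_def)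
  have le: "exp (s * (inner_n d v (X z) + (norm_n d (X z))\<^sup>2 / (2 * R)))
             * indicator {..B} (norm_n d (X z)) \<le> G z" for z
  proof -
    have "\<bar>inner_n d v (X z)\<bar> \<le> 1 * norm_n d (X z)"
      by (rule order.trans[OF inner_n_le_norm mult_right_mono[OF v]]) simp
    then have "\<bar>s * inner_n d v (X z)\<bar> \<le> s * norm_n d (X z)"
      using s by (simp add: abs_mult)
    from truncated_exp_bound[OF q_ge_1 s _ B this] show ?thesis
      by (simp add: G_def A_def algebra_simps)
  qed
  have G_eq: "G z = 1 + s * inner_n d v (X z) + A * s / (2 * R) * (norm_n d (X z))\<^sup>2
     + 2 * exp q * s\<^sup>2 * (inner_n d v (X z))\<^sup>2
     + 3 * exp (3 / 2 * s * B) / B powr q * norm_n d (X z) powr q" for z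
    using B by (simp add: G_def power_mult_distrib powr_divide)
  note [simp] = inner_integrable norm_square_integrable inner_square_integrable powr_integrable
  have G_int: "integrable P G" unfolding G_eq[abs_def] by auto
  have "(\<integral>z. G z \<partial>P) = 1 + A * s / (2 * R) * (\<integral>z. (norm_n d (X z))\<^sup>2 \<partial>P)
     + 2 * exp q * s\<^sup>2 * (\<integral>z. (inner_n d v (X z))\<^sup>2 \<partial>P)
     + 3 * exp (3 / 2 * s * B) / B powr q * (\<integral>z. norm_n d (X z) powr q \<partial>P)"
    unfolding G_eq by (simp add: inner_mean_zero prob_space)
  also have "\<dots> \<le> 1 + A * s / (2 * R) * (real d * lam) + 2 * exp q * s\<^sup>2 * lam
     + 3 * exp (3 / 2 * s * B) / B powr q * m"
    using A s B norm_square_expectation weak_variance[OF v] powr_moment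
    by (intro add_mono mult_left_mono) auto
  also have "\<dots> \<le> step_bound s B R"
    using exp_ge_add_one_self[of "A * s * (real d * lam) / (2 * R) + 2 * exp q * s\<^sup>2 * lam
       + 3 * exp (3 / 2 * s * B) * m / B powr q"]
    by (simp add: step_bound_def A_def add.assoc)
  finally have bound: "(\<integral>z. G z \<partial>P) \<le> step_bound s B R" .
  have G0: "0 \<le> G z" for z by (rule order.trans[OF _ le[of z]]) simp
  have "(\<integral>\<^sup>+z. ennreal (exp (s * (inner_n d v (X z) + (norm_n d (X z))\<^sup>2 / (2 * R)))
             * indicator {..B} (norm_n d (X z))) \<partial>P) \<le> (\<integral>\<^sup>+z. ennreal (G z) \<partial>P)"
    by (intro nn_integral_mono ennreal_leI le)
  also have "\<dots> = ennreal (\<integral>z. G z \<partial>P)"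
    using G_int G0 by (intro nn_integral_eq_integral) auto
  also have "\<dots> \<le> ennreal (step_bound s B R)"
    using bound by (rule ennreal_leI)
  finally show ?thesis .
qed

section \<open>Exponential moments and tails of sums of independent copies\<close>

definition smoothed_norm :: "real \<Rightarrow> rvec \<Rightarrow> real" where
  "smoothed_norm R x = sqrt (R\<^sup>2 + (norm_n d x)\<^sup>2)"

lemma component_measurable:
  "i \<in> I \<Longrightarrow> j < d \<Longrightarrow> (\<lambda>D. X (D i) j) \<in> borel_measurable (\<Pi>\<^sub>M i\<in>I. P)"
  by (rule measurable_compose[OF measurable_component_singleton[of i I "\<lambda>_. P"] X_measurable])

lemma component_norm_measurable:
  "i \<in> I \<Longrightarrow> (\<lambda>D. norm_n d (X (D i))) \<in> borel_measurable (\<Pi>\<^sub>M i\<in>I. P)"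
  by (rule measurable_compose[OF measurable_component_singleton[of i I "\<lambda>_. P"] norm_measurable])

lemma norm_sum_measurable:
  "(\<lambda>D. norm_n d (\<lambda>j. \<Sum>i\<in>I. X (D i) j)) \<in> borel_measurable (\<Pi>\<^sub>M i\<in>I. P)"
  unfolding norm_n_def
  by (intro measurable_compose[OF _ borel_measurable_sqrt] borel_measurable_sum borel_measurable_power component_measurable) auto

text \<open>Induction on the index set, integrating out one coordinate with the others fixed. The
  empty sum has smoothed norm \<open>R\<close>, whence the factor
  \<open>exp (s * R)\<close>.\<close>

lemma nn_integral_exp_smoothed_norm_le:
  fixes I :: "'i set"
  assumes I: "finite I" and s: "0 < s" and B: "0 < B" "B \<le> R"
  defines "F \<equiv> \<lambda>I D. exp (s * smoothed_norm R (\<lambda>j. \<Sum>i\<in>I. X (D i) j))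
             * (\<Prod>i\<in>I. indicator {..B} (norm_n d (X (D i))))"
  shows "(\<integral>\<^sup>+D. ennreal (F I D) \<partial>(\<Pi>\<^sub>M i\<in>I. P)) \<le> ennreal (exp (s * R) * step_bound s B R ^ card I)"
  using I
proof (induction I)
  case empty
  have "0 \<le> R" using B by simp
  then show ?case
    by (simp add: F_def smoothed_norm_def norm_n_def PiM_empty nn_integral_count_space_finite)
next
  case (insert i I)
  interpret product_sigma_finite "\<lambda>_::'i. P" by unfold_locales
  have R: "0 < R" using B by simp
  have F_nonneg: "0 \<le> F J D" for J D by (simp add: F_def prod_nonneg)
  have F_meas: "(\<lambda>D. ennreal (F J D)) \<in> borel_measurable (\<Pi>\<^sub>M i\<in>J. P)" for J
    unfolding F_def smoothed_norm_def
    by (intro measurable_compose[OF _ measurable_ennreal] borel_measurable_times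
        measurable_compose[OF _ borel_measurable_exp] borel_measurable_const
        measurable_compose[OF _ borel_measurable_sqrt] borel_measurable_add borel_measurable_power norm_sum_measurable
        borel_measurable_prod measurable_compose[OF component_norm_measurable] borel_measurable_indicator) auto
  have step: "(\<integral>\<^sup>+z. ennreal (F (insert i I) (D(i := z))) \<partial>P) \<le> ennreal (F I D) * ennreal (step_bound s B R)" for D
  proof -
    define S where "S = (\<lambda>j. \<Sum>k\<in>I. X (D k) j)"
    \<comment> \<open>The gradient of the smoothed norm at \<open>S\<close>. It depends only on the
      fixed coordinates, so it is a constant direction for the inner integral.\<close>
    define v where "v = (\<lambda>j. S j / smoothed_norm R S)"
    have pos: "0 < smoothed_norm R S" using R by (auto simp: smoothed_norm_def intro!: add_pos_nonneg)
    have "norm_n d v = norm_n d S / smoothed_norm R S"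
      using pos by (simp add: norm_n_def v_def power_divide sum_divide_distrib[symmetric] real_sqrt_divide)
    also have "\<dots> \<le> 1"
      using pos by (simp add: smoothed_norm_def real_le_rsqrt)
    finally have v: "norm_n d v \<le> 1" .
    have inner_v: "inner_n d v x = inner_n d S x / smoothed_norm R S" for x
      by (simp add: inner_n_def v_def sum_divide_distrib)
    have le: "F (insert i I) (D(i := z)) \<le> F I D * (exp (s * (inner_n d v (X z) + (norm_n d (X z))\<^sup>2 / (2 * R)))
             * indicator {..B} (norm_n d (X z)))" for z
    proof -
      define pr where "pr = (\<Prod>k\<in>I. indicator {..B} (norm_n d (X (D k))) :: real)"
      have pr0: "0 \<le> pr" by (simp add: pr_def prod_nonneg)
      have upd: "(D(i := z)) k = D k" if "k \<in> I" for k using that insert.hyps by auto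
      have sum: "(\<lambda>j. \<Sum>k\<in>insert i I. X ((D(i := z)) k) j) = (\<lambda>j. S j + X z j)"
        using insert.hyps upd by (simp add: S_def add.commute cong: sum.cong)
      have prod: "(\<Prod>k\<in>insert i I. indicator {..B} (norm_n d (X ((D(i := z)) k))) :: real)
          = indicator {..B} (norm_n d (X z)) * pr"
        using insert.hyps upd by (simp add: pr_def cong: prod.cong)
      have "smoothed_norm R (\<lambda>j. S j + X z j)
          \<le> smoothed_norm R S + (inner_n d v (X z) + (norm_n d (X z))\<^sup>2 / (2 * R))"
        using smoothed_norm_add_le[OF R, of d S "X z"] inner_v[of "X z"] by (simp add: smoothed_norm_def)
      then have "s * smoothed_norm R (\<lambda>j. S j + X z j)
          \<le> s * smoothed_norm R S + s * (inner_n d v (X z) + (norm_n d (X z))\<^sup>2 / (2 * R))"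
        using s mult_left_mono[of _ _ s] by (simp add: distrib_left[symmetric])
      then have "exp (s * smoothed_norm R (\<lambda>j. S j + X z j))
          \<le> exp (s * smoothed_norm R S) * exp (s * (inner_n d v (X z) + (norm_n d (X z))\<^sup>2 / (2 * R)))"
        by (simp add: exp_add[symmetric])
      then have "exp (s * smoothed_norm R (\<lambda>j. S j + X z j)) * (indicator {..B} (norm_n d (X z)) * pr)
          \<le> exp (s * smoothed_norm R S) * exp (s * (inner_n d v (X z) + (norm_n d (X z))\<^sup>2 / (2 * R)))
            * (indicator {..B} (norm_n d (X z)) * pr)"
        using pr0 by (intro mult_right_mono) auto
      then show ?thesis unfolding F_def sum prod S_def[symmetric] pr_def[symmetric] by (simp add: mult_ac)
    qed
    have "(\<integral>\<^sup>+z. ennreal (F (insert i I) (D(i := z))) \<partial>P)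
      \<le> (\<integral>\<^sup>+z. ennreal (F I D) * ennreal (exp (s * (inner_n d v (X z) + (norm_n d (X z))\<^sup>2 / (2 * R)))
             * indicator {..B} (norm_n d (X z))) \<partial>P)"
      using le F_nonneg by (intro nn_integral_mono) (simp add: ennreal_mult'[symmetric] ennreal_leI)
    also have "\<dots> = ennreal (F I D) * (\<integral>\<^sup>+z. ennreal (exp (s * (inner_n d v (X z) + (norm_n d (X z))\<^sup>2 / (2 * R)))
             * indicator {..B} (norm_n d (X z))) \<partial>P)"
      by (rule nn_integral_cmult) measurable
    also have "\<dots> \<le> ennreal (F I D) * ennreal (step_bound s B R)"
      by (intro mult_left_mono nn_integral_step_le v s B) simp
    finally show ?thesis .
  qed
  have "(\<integral>\<^sup>+D. ennreal (F (insert i I) D) \<partial>(\<Pi>\<^sub>M i\<in>insert i I. P))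
      = (\<integral>\<^sup>+D. (\<integral>\<^sup>+z. ennreal (F (insert i I) (D(i := z))) \<partial>P) \<partial>(\<Pi>\<^sub>M i\<in>I. P))"
    using insert.hyps F_meas by (intro product_nn_integral_insert) auto
  also have "\<dots> \<le> (\<integral>\<^sup>+D. ennreal (F I D) * ennreal (step_bound s B R) \<partial>(\<Pi>\<^sub>M i\<in>I. P))"
    by (intro nn_integral_mono step)
  also have "\<dots> = (\<integral>\<^sup>+D. ennreal (F I D) \<partial>(\<Pi>\<^sub>M i\<in>I. P)) * ennreal (step_bound s B R)"
    by (rule nn_integral_multc[OF F_meas])
  also have "\<dots> \<le> ennreal (exp (s * R) * step_bound s B R ^ card I) * ennreal (step_bound s B R)"
    using insert.IH by (rule mult_right_mono) simp
  also have "\<dots> = ennreal (exp (s * R) * step_bound s B R ^ card (insert i I))"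
    using insert.hyps by (simp add: ennreal_mult'[symmetric] step_bound_def mult_ac)
  finally show ?case .
qed

lemma emeasure_norm_gt_le:
  assumes "0 < B"
  shows "emeasure P {z \<in> space P. B < norm_n d (X z)} \<le> ennreal (m / B powr q)"
proof -
  have "{z \<in> space P. B < norm_n d (X z)}
      \<subseteq> {z \<in> space P. 1 \<le> ennreal (1 / B powr q) * ennreal (norm_n d (X z) powr q)}"
  proof safe
    fix z assume "B < norm_n d (X z)"
    then have "B powr q \<le> norm_n d (X z) powr q"
      using assms q_ge_1 by (intro powr_mono2) auto
    then show "1 \<le> ennreal (1 / B powr q) * ennreal (norm_n d (X z) powr q)"
      using assms by (simp add: ennreal_mult'[symmetric] flip: ennreal_1)
  qed
  then have "emeasure P {z \<in> space P. B < norm_n d (X z)}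
      \<le> emeasure P {z \<in> space P. 1 \<le> ennreal (1 / B powr q) * ennreal (norm_n d (X z) powr q)}"
    by (rule emeasure_mono) measurable
  also have "\<dots> \<le> ennreal (1 / B powr q) * (\<integral>\<^sup>+z. ennreal (norm_n d (X z) powr q) * indicator (space P) z \<partial>P)"
    by (rule nn_integral_Markov_inequality) measurable
  also have "(\<integral>\<^sup>+z. ennreal (norm_n d (X z) powr q) * indicator (space P) z \<partial>P)
      = (\<integral>\<^sup>+z. ennreal (norm_n d (X z) powr q) \<partial>P)"
    by (intro nn_integral_cong) simp
  also have "\<dots> = ennreal (\<integral>z. norm_n d (X z) powr q \<partial>P)"
    using powr_integrable by (intro nn_integral_eq_integral) auto
  also have "ennreal (1 / B powr q) * \<dots> \<le> ennreal (1 / B powr q) * ennreal m"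
    by (intro mult_left_mono ennreal_leI powr_moment) simp
  also have "\<dots> = ennreal (m / B powr q)"
    by (simp add: ennreal_mult'[symmetric])
  finally show ?thesis .
qed

text \<open>Either some summand is longer than \<open>B\<close>, which the union bound controls, or
  all truncation indicators equal 1 and the Chernoff bound applies to the smoothed norm, which
  dominates the norm.\<close>

lemma emeasure_norm_sum_gt_le:
  fixes I :: "'i set"
  assumes I: "finite I" and s: "0 < s" and B: "0 < B" "B \<le> R"
  shows "emeasure (\<Pi>\<^sub>M i\<in>I. P) {D \<in> space (\<Pi>\<^sub>M i\<in>I. P). t < norm_n d (\<lambda>j. \<Sum>i\<in>I. X (D i) j)}
     \<le> ennreal (card I * (m / B powr q) + exp (s * R - s * t) * step_bound s B R ^ card I)"
proof -
  interpret prod: product_prob_space "\<lambda>_::'i. P" I by unfold_locales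
  let ?Q = "\<Pi>\<^sub>M i\<in>I. P"
  define F where "F D = exp (s * smoothed_norm R (\<lambda>j. \<Sum>i\<in>I. X (D i) j))
             * (\<Prod>i\<in>I. indicator {..B} (norm_n d (X (D i))) :: real)" for D
  define E1 where "E1 = (\<Union>i\<in>I. {D \<in> space ?Q. B < norm_n d (X (D i))})"
  define E2 where "E2 = {D \<in> space ?Q. 1 \<le> ennreal (exp (- s * t)) * ennreal (F D)}"
  have F_nonneg: "0 \<le> F D" for D by (simp add: F_def prod_nonneg)
  have F_meas: "F \<in> borel_measurable ?Q"
    unfolding F_def smoothed_norm_def
    by (intro borel_measurable_times
        measurable_compose[OF _ borel_measurable_exp] borel_measurable_const
        measurable_compose[OF _ borel_measurable_sqrt] borel_measurable_add borel_measurable_power norm_sum_measurable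
        borel_measurable_prod measurable_compose[OF component_norm_measurable] borel_measurable_indicator) auto
  have E1_sets: "{D \<in> space ?Q. B < norm_n d (X (D i))} \<in> sets ?Q" if "i \<in> I" for i
    using component_norm_measurable[OF that] by measurable
  have E2_sets: "E2 \<in> sets ?Q" unfolding E2_def using F_meas by measurable
  have "{D \<in> space ?Q. t < norm_n d (\<lambda>j. \<Sum>i\<in>I. X (D i) j)} \<subseteq> E1 \<union> E2"
  proof
    fix D assume D: "D \<in> {D \<in> space ?Q. t < norm_n d (\<lambda>j. \<Sum>i\<in>I. X (D i) j)}"
    show "D \<in> E1 \<union> E2"
    proof (cases "\<exists>i\<in>I. B < norm_n d (X (D i))")
      case False
      then have "F D = exp (s * smoothed_norm R (\<lambda>j. \<Sum>i\<in>I. X (D i) j))"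
        by (auto simp: F_def not_less intro!: prod.neutral)
      moreover have "norm_n d (\<lambda>j. \<Sum>i\<in>I. X (D i) j) \<le> smoothed_norm R (\<lambda>j. \<Sum>i\<in>I. X (D i) j)"
        by (simp add: smoothed_norm_def real_le_rsqrt)
      then have "s * t \<le> s * smoothed_norm R (\<lambda>j. \<Sum>i\<in>I. X (D i) j)"
        using s D by (intro mult_left_mono) auto
      ultimately have "1 \<le> exp (- s * t) * F D"
        by (simp add: exp_add[symmetric])
      then have "1 \<le> ennreal (exp (- s * t)) * ennreal (F D)"
        using F_nonneg by (simp add: ennreal_mult'[symmetric] flip: ennreal_1)
      with D show ?thesis by (simp add: E2_def)
    qed (use D in \<open>auto simp: E1_def\<close>)
  qed
  then have "emeasure ?Q {D \<in> space ?Q. t < norm_n d (\<lambda>j. \<Sum>i\<in>I. X (D i) j)} \<le> emeasure ?Q (E1 \<union> E2)"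
    using E1_sets E2_sets I by (intro emeasure_mono) (auto simp: E1_def intro!: sets.Un sets.finite_UN)
  also have "\<dots> \<le> emeasure ?Q E1 + emeasure ?Q E2"
    using E1_sets E2_sets I by (intro emeasure_subadditive) (auto simp: E1_def)
  also have "\<dots> \<le> ennreal (card I * (m / B powr q)) + ennreal (exp (s * R - s * t) * step_bound s B R ^ card I)"
  proof (rule add_mono)
    have "emeasure ?Q {D \<in> space ?Q. B < norm_n d (X (D i))} \<le> ennreal (m / B powr q)" if i: "i \<in> I" for i
    proof -
      have "{D \<in> space ?Q. B < norm_n d (X (D i))}
          = (\<lambda>D. D i) -` {z \<in> space P. B < norm_n d (X z)} \<inter> space ?Q"
        using i by (auto simp: space_PiM)
      then have "emeasure ?Q {D \<in> space ?Q. B < norm_n d (X (D i))}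
          = emeasure (distr ?Q P (\<lambda>D. D i)) {z \<in> space P. B < norm_n d (X z)}"
        using i by (simp add: emeasure_distr measurable_component_singleton)
      also have "distr ?Q P (\<lambda>D. D i) = P"
        using prod.PiM_component[OF i] by simp
      finally show ?thesis using emeasure_norm_gt_le[OF B(1)] by simp
    qed
    then have "(\<Sum>i\<in>I. emeasure ?Q {D \<in> space ?Q. B < norm_n d (X (D i))}) \<le> (\<Sum>i\<in>I. ennreal (m / B powr q))"
      by (rule sum_mono)
    moreover have "emeasure ?Q E1 \<le> (\<Sum>i\<in>I. emeasure ?Q {D \<in> space ?Q. B < norm_n d (X (D i))})"
      unfolding E1_def using E1_sets I by (intro emeasure_subadditive_finite) auto
    ultimately have "emeasure ?Q E1 \<le> (\<Sum>i\<in>I. ennreal (m / B powr q))" by (rule order.trans[rotated])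
    also have "\<dots> = ennreal (card I * (m / B powr q))"
      using moment_nonneg by (simp add: ennreal_of_nat_eq_real_of_nat ennreal_mult'[symmetric])
    finally show "emeasure ?Q E1 \<le> ennreal (card I * (m / B powr q))" .
  next
    have "emeasure ?Q E2 \<le> ennreal (exp (- s * t)) * (\<integral>\<^sup>+D. ennreal (F D) * indicator (space ?Q) D \<partial>?Q)"
      unfolding E2_def using F_meas by (intro nn_integral_Markov_inequality) auto
    also have "(\<integral>\<^sup>+D. ennreal (F D) * indicator (space ?Q) D \<partial>?Q) = (\<integral>\<^sup>+D. ennreal (F D) \<partial>?Q)"
      by (intro nn_integral_cong) simp
    also have "ennreal (exp (- s * t)) * \<dots> \<le> ennreal (exp (- s * t)) * ennreal (exp (s * R) * step_bound s B R ^ card I)"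
      unfolding F_def by (intro mult_left_mono nn_integral_exp_smoothed_norm_le I s B) simp
    also have "\<dots> = ennreal (exp (s * R - s * t) * step_bound s B R ^ card I)"
      by (simp add: ennreal_mult'[symmetric] exp_diff exp_minus field_simps)
    finally show "emeasure ?Q E2 \<le> ennreal (exp (s * R - s * t) * step_bound s B R ^ card I)" .
  qed
  also have "\<dots> = ennreal (card I * (m / B powr q) + exp (s * R - s * t) * step_bound s B R ^ card I)"
    using moment_nonneg by (intro ennreal_plus[symmetric]) (auto simp: step_bound_def)
  finally show ?thesis .
qed

text \<open>The truncation level \<open>B\<close> makes the union bound over the summands equal to \<open>\<epsilon> / 2\<close>, and
  \<open>s\<close> may be of order \<open>ln (2 / \<epsilon>) / B\<close> because the remainder \<open>exp (3 / 2 * s * B) * N * m / B powr q\<close>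
  then stays bounded; this is why no logarithm multiplies \<open>B\<close>.\<close>

lemma fuk_nagaev:
  fixes I :: "'i set" and \<epsilon> :: real
  assumes I: "finite I" "I \<noteq> {}" and eps: "0 < \<epsilon>" "\<epsilon> < 1" and pos: "0 < m" "0 < lam"
  defines "N \<equiv> real (card I)"
  defines "B \<equiv> (2 * N * m / \<epsilon>) powr (1 / q)"
  shows "emeasure (\<Pi>\<^sub>M i\<in>I. P) {D \<in> space (\<Pi>\<^sub>M i\<in>I. P).
      (22 + 4 * q * exp q) * (sqrt (N * lam * (real d + ln (2 / \<epsilon>))) + B)
        < norm_n d (\<lambda>j. \<Sum>i\<in>I. X (D i) j)} \<le> ennreal \<epsilon>"
proof -
  define A where "A = 1 + 2 * q * exp q"
  define x where "x = ln (2 / \<epsilon>)"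
  \<comment> \<open>\<open>R\<close> dominates \<open>B\<close>, as the truncated bound requires,
    and also the root of the total trace variance, which keeps the accumulated curvature term below
    \<open>A * s * R\<close>.\<close>
  define R where "R = sqrt (N * (real d * lam)) + B"
  \<comment> \<open>The first entry keeps \<open>exp (3 / 2 * s * B)\<close> below
    \<open>2 / \<epsilon>\<close>. The second balances the variance term \<open>s * N * lam\<close>
    against \<open>x / s\<close>.\<close>
  define s where "s = min (2 * x / (3 * B)) (sqrt (x / (N * lam)))"
  \<comment> \<open>Solved from the exponent: \<open>s * t\<close> exceeds the bounds on all growth
    terms together by \<open>x\<close>, and \<open>exp (- x) = \<epsilon> / 2\<close>.\<close>
  define t where "t = (1 + A) * R + A * s * N * lam + (3 + x) / s"
  have N: "0 < N" using I by (simp add: N_def card_gt_0_iff)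
  have A1: "1 \<le> A" "2 * exp q \<le> A"
  proof -
    have "exp q \<le> q * exp q" using q_ge_1 by simp
    moreover have "0 \<le> q * exp q" using q_ge_1 by simp
    ultimately show "2 * exp q \<le> A" "1 \<le> A" unfolding A_def by linarith+
  qed
  have "ln 2 \<le> x" unfolding x_def using eps by (intro ln_mono) (auto simp: field_simps)
  then have x: "2 / 3 \<le> x" using ln2_ge_two_thirds by linarith
  have expx: "exp x = 2 / \<epsilon>" using eps by (simp add: x_def)
  have B: "0 < B" using N pos eps by (simp add: B_def)
  have Bq: "B powr q = 2 * N * m / \<epsilon>"
    using N pos eps q_ge_1 by (simp add: B_def powr_powr)
  have NmB: "N * m / B powr q = \<epsilon> / 2" unfolding Bq using N pos eps by simp
  have BR: "B \<le> R" using N pos by (simp add: R_def)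
  have R: "0 < R" using B BR by simp
  have s: "0 < s" using x B N pos by (simp add: s_def)
  have sB: "3 / 2 * s * B \<le> x"
  proof -
    have "s \<le> 2 * x / (3 * B)" by (simp add: s_def)
    then show ?thesis using B by (simp add: field_simps)
  qed
  have sN: "s * (N * lam) \<le> sqrt (x * (N * lam))"
  proof -
    have "s * (N * lam) \<le> sqrt (x / (N * lam)) * (N * lam)"
      using N pos by (intro mult_right_mono) (auto simp: s_def)
    also have "\<dots> = sqrt (x * (N * lam))"
      using N pos by (simp add: real_sqrt_divide real_sqrt_mult field_simps)
    finally show ?thesis .
  qed
  \<comment> \<open>The reciprocal of a minimum is the larger of the two reciprocals, hence at most
    their sum.\<close>
  have xs: "x / s \<le> 3 / 2 * B + sqrt (x * (N * lam))"
  proof (cases "s = 2 * x / (3 * B)")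
    case True
    then have "x / s = 3 / 2 * B" using x B by simp
    then show ?thesis using N pos x by (simp del: times_divide_eq_left)
  next
    case False
    then have "s = sqrt (x / (N * lam))" by (auto simp: s_def min_def split: if_splits)
    then have "s * sqrt (x * (N * lam)) = sqrt (x / (N * lam) * (x * (N * lam)))"
      by (simp only: real_sqrt_mult)
    also have "x / (N * lam) * (x * (N * lam)) = x\<^sup>2"
      using N pos by (simp add: power2_eq_square)
    also have "sqrt (x\<^sup>2) = x" using x by simp
    finally have "x / s = sqrt (x * (N * lam))"
      using s by (simp add: field_simps)
    then show ?thesis using B by simp
  qed
  define Y where "Y = N * (real d * lam)"
  have "Y \<le> R * R"
  proof -
    have "0 \<le> Y" using N pos by (simp add: Y_def)
    then have "Y = sqrt Y * sqrt Y" by simp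
    also have "\<dots> \<le> R * R" using B \<open>0 \<le> Y\<close> by (intro mult_mono) (auto simp: R_def Y_def[symmetric])
    finally show ?thesis .
  qed
  then have YR: "Y / R \<le> R" using R by (simp add: field_simps)
  have e1: "N * (A * s * (real d * lam) / (2 * R)) \<le> A * s * R"
  proof -
    have "N * (A * s * (real d * lam) / (2 * R)) = A * s * (Y / R) / 2" by (simp add: Y_def mult_ac)
    also have "\<dots> \<le> A * s * (Y / R)"
    proof -
      have "0 \<le> A * s * (Y / R)" using A1 s N pos R by (simp add: Y_def)
      moreover have "z / 2 \<le> z" if "0 \<le> z" for z :: real using that by simp
      ultimately show ?thesis by blast
    qed
    also have "\<dots> \<le> A * s * R" using YR A1 s by (intro mult_left_mono) auto
    finally show ?thesis .
  qed
  have e2: "N * (2 * exp q * s\<^sup>2 * lam) \<le> A * s * N * lam * s"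
  proof -
    have "2 * exp q * (s\<^sup>2 * (N * lam)) \<le> A * (s\<^sup>2 * (N * lam))"
      using A1 s N pos by (intro mult_right_mono) auto
    then show ?thesis by (simp add: power2_eq_square mult_ac)
  qed
  have e3: "N * (3 * exp (3 / 2 * s * B) * m / B powr q) \<le> 3"
  proof -
    have "N * (3 * exp (3 / 2 * s * B) * m / B powr q) = 3 * exp (3 / 2 * s * B) * (\<epsilon> / 2)"
      unfolding NmB[symmetric] by simp
    also have "\<dots> \<le> 3 * exp x * (\<epsilon> / 2)" using sB eps by (intro mult_right_mono mult_left_mono) auto
    finally show ?thesis using eps by (simp add: expx)
  qed
  have st: "s * t = s * R + A * s * R + A * s * N * lam * s + 3 + x"
    using s by (simp add: t_def field_simps)
  have "step_bound s B R ^ card I = exp (N * (A * s * (real d * lam) / (2 * R)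
      + 2 * exp q * s\<^sup>2 * lam + 3 * exp (3 / 2 * s * B) * m / B powr q))"
    by (simp add: step_bound_def N_def A_def exp_of_nat_mult)
  then have "exp (s * R - s * t) * step_bound s B R ^ card I
      = exp (s * R - s * t + N * (A * s * (real d * lam) / (2 * R)
      + 2 * exp q * s\<^sup>2 * lam + 3 * exp (3 / 2 * s * B) * m / B powr q))"
    by (simp add: exp_add)
  also have "\<dots> \<le> exp (- x)"
    using e1 e2 e3 st by (simp add: distrib_left)
  also have "\<dots> = \<epsilon> / 2" by (simp add: exp_minus expx)
  finally have tail: "exp (s * R - s * t) * step_bound s B R ^ card I \<le> \<epsilon> / 2" .
  define U where "U = sqrt (N * lam * (real d + x))"
  have U: "sqrt (x * (N * lam)) \<le> U" "sqrt (N * (real d * lam)) \<le> U"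
    using N pos x by (auto simp: U_def field_simps)
  have "t \<le> (22 + 4 * q * exp q) * (U + B)"
  proof -
    have "(1 + A) * R \<le> (1 + A) * (U + B)"
      using U A1 by (intro mult_left_mono) (auto simp: R_def)
    moreover have "A * s * N * lam \<le> A * U"
      using mult_left_mono[of "s * (N * lam)" U A] A1 sN U by (simp add: mult_ac)
    \<comment> \<open>\<open>3 + x \<le> 6 * x\<close> follows from \<open>x \<ge> 2 / 3\<close>,
      which comes from \<open>\<epsilon> < 1\<close>.\<close>
    moreover have "(3 + x) / s \<le> 6 * (x / s)"
      using x s by (simp add: field_simps)
    then have "(3 + x) / s \<le> 9 * B + 6 * U" using xs U by linarith
    ultimately have "t \<le> (1 + A) * (U + B) + A * U + (9 * B + 6 * U)" by (simp add: t_def)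
    \<comment> \<open>With \<open>22 + 4 * q * exp q = 20 + 2 * A\<close>, the coefficients to cover
      are \<open>7 + 2 * A\<close> for \<open>U\<close> and \<open>10 + A\<close> for
      \<open>B\<close>.\<close>
    also have "\<dots> \<le> (22 + 4 * q * exp q) * (U + B)"
    proof -
      have "0 \<le> U" "0 \<le> B" "0 \<le> A * B" using N pos x B A1 by (auto simp: U_def)
      moreover have C: "22 + 4 * q * exp q = 20 + 2 * A" by (simp add: A_def)
      moreover have "0 \<le> A * U" using A1 \<open>0 \<le> U\<close> by simp
      ultimately show ?thesis unfolding C by (simp add: algebra_simps)
    qed
    finally show ?thesis .
  qed
  then have "emeasure (\<Pi>\<^sub>M i\<in>I. P) {D \<in> space (\<Pi>\<^sub>M i\<in>I. P).
      (22 + 4 * q * exp q) * (U + B) < norm_n d (\<lambda>j. \<Sum>i\<in>I. X (D i) j)}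
    \<le> emeasure (\<Pi>\<^sub>M i\<in>I. P) {D \<in> space (\<Pi>\<^sub>M i\<in>I. P). t < norm_n d (\<lambda>j. \<Sum>i\<in>I. X (D i) j)}"
    using norm_sum_measurable[of I] by (intro emeasure_mono) auto
  also have "\<dots> \<le> ennreal (card I * (m / B powr q) + exp (s * R - s * t) * step_bound s B R ^ card I)"
    by (rule emeasure_norm_sum_gt_le[OF I(1) s B BR])
  also have "\<dots> \<le> ennreal \<epsilon>"
  proof (intro ennreal_leI)
    have "card I * (m / B powr q) = \<epsilon> / 2" using NmB by (simp add: N_def)
    then show "card I * (m / B powr q) + exp (s * R - s * t) * step_bound s B R ^ card I \<le> \<epsilon>"
      by (rule order.trans[OF add_mono[OF eq_refl tail]]) simp
  qed
  finally show ?thesis unfolding U_def x_def .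
qed

end

subsection \<open>Power means and gradients of convex functions\<close>

text \<open>Bernoulli's inequality: a convex function lies above its tangent, here at 1. The tangent
  argument runs on the open half-line, so \<open>u = 0\<close> stands apart.\<close>

lemma powr_ge_tangent:
  fixes u p :: real
  assumes "1 \<le> p" "0 \<le> u"
  shows "1 + p * (u - 1) \<le> u powr p"
proof (cases "u = 0")
  case False
  have "((\<lambda>x. x powr p) has_real_derivative p * 1 powr (p - 1)) (at 1 within {0<..})"
    by (rule has_field_derivative_at_within[OF has_real_derivative_powr]) simp
  then have "p * (u - 1) \<le> u powr p - 1 powr p"
    using convex_on_imp_above_tangent[OF powr_convex[OF assms(1)], of 1 u p] False assms
    by (simp add: interior_open)
  then show ?thesis by simp
qed (use assms in auto)

lemma square_powr_half: "(y\<^sup>2) powr (q / 2) = \<bar>y\<bar> powr q" for y q :: real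
proof (cases "y = 0")
  case False
  then have "y\<^sup>2 = \<bar>y\<bar> powr 2" by simp
  then show ?thesis by (simp only: powr_powr) simp
qed simp

text \<open>The power mean inequality, from the tangent of the power \<open>q / 2\<close> at the
  mean \<open>M\<close> of the squared coordinates; the linear parts cancel in the sum.\<close>

lemma norm_n_powr_le:
  assumes d: "0 < d" and q: "2 \<le> q"
  shows "norm_n d x powr q \<le> real d powr (q / 2 - 1) * (\<Sum>j<d. \<bar>x j\<bar> powr q)"
proof (cases "norm_n d x = 0")
  case False
  define M where "M = (norm_n d x)\<^sup>2 / real d"
  have M: "0 < M" using d False by (simp add: M_def)
  have sum: "(\<Sum>j<d. (x j)\<^sup>2) = real d * M"
    using d by (simp add: M_def norm_n_square)
  have "M powr (q / 2) * (1 + q / 2 * ((x j)\<^sup>2 / M - 1)) \<le> \<bar>x j\<bar> powr q" for j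
  proof -
    have "M powr (q / 2) * (1 + q / 2 * ((x j)\<^sup>2 / M - 1)) \<le> M powr (q / 2) * ((x j)\<^sup>2 / M) powr (q / 2)"
      using q M by (intro mult_left_mono powr_ge_tangent) auto
    also have "\<dots> = \<bar>x j\<bar> powr q"
      using M by (simp add: powr_divide square_powr_half)
    finally show ?thesis .
  qed
  then have "(\<Sum>j<d. M powr (q / 2) * (1 + q / 2 * ((x j)\<^sup>2 / M - 1))) \<le> (\<Sum>j<d. \<bar>x j\<bar> powr q)"
    by (rule sum_mono)
  also have "(\<Sum>j<d. M powr (q / 2) * (1 + q / 2 * ((x j)\<^sup>2 / M - 1)))
      = M powr (q / 2) * (\<Sum>j<d. 1 + q / 2 * ((x j)\<^sup>2 / M - 1))"
    by (simp add: sum_distrib_left)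
  also have "(\<Sum>j<d. 1 + q / 2 * ((x j)\<^sup>2 / M - 1)) = real d"
    using M by (simp add: sum.distrib sum_distrib_left[symmetric] sum_subtractf sum_divide_distrib[symmetric] sum)
  finally have "real d * M powr (q / 2) \<le> (\<Sum>j<d. \<bar>x j\<bar> powr q)" by (simp add: mult.commute)
  then have "real d powr (q / 2 - 1) * (real d * M powr (q / 2))
      \<le> real d powr (q / 2 - 1) * (\<Sum>j<d. \<bar>x j\<bar> powr q)"
    by (intro mult_left_mono) auto
  also have "real d powr (q / 2 - 1) * (real d * M powr (q / 2)) = (real d * M) powr (q / 2)"
    using d M by (simp add: powr_diff powr_mult)
  also have "\<dots> = ((norm_n d x)\<^sup>2) powr (q / 2)" using d by (simp add: M_def)
  also have "\<dots> = norm_n d x powr q"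
    by (simp add: square_powr_half)
  finally show ?thesis .
qed (simp add: sum_nonneg)

text \<open>Difference quotients along the chord tend to the directional derivative, and convexity
  bounds them by the full increment. The chord stays in \<open>S\<close>, where the gradient
  estimate holds.\<close>

lemma convex_fun_n_gradient_le:
  assumes conv: "convex_fun_n d S f" and grad: "has_gradient_n d S f g x" and x: "x \<in> S" and y: "y \<in> S"
  shows "inner_n d g (\<lambda>i. y i - x i) \<le> f y - f x"
proof (rule field_le_epsilon)
  fix e :: real assume e: "0 < e"
  define D where "D = dist_n d y x"
  have D: "0 \<le> D" by (simp add: D_def dist_n_def)
  have eD: "0 < e / (D + 1)" "e / (D + 1) * D \<le> e" using e D by (auto simp: field_simps)
  obtain s where s: "0 < s" "\<And>z. z \<in> S \<Longrightarrow> dist_n d z x < s \<Longrightarrow>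
      \<bar>f z - f x - inner_n d g (\<lambda>i. z i - x i)\<bar> \<le> e / (D + 1) * dist_n d z x"
    using grad eD(1) unfolding has_gradient_n_def by metis
  \<comment> \<open>Small enough that the point on the chord lies within \<open>s\<close> of
    \<open>x\<close>; \<open>D + 1\<close> avoids division by zero when the distance is 0.\<close>
  define t where "t = min 1 (s / (2 * (D + 1)))"
  have t: "0 < t" "t \<le> 1" using s D by (auto simp: t_def)
  have "t * D \<le> s / (2 * (D + 1)) * D" using D by (intro mult_right_mono) (auto simp: t_def)
  also have "\<dots> = s * (D / (2 * (D + 1)))" by simp
  also have "\<dots> < s * 1" using s D by (intro mult_strict_left_mono) (auto simp: field_simps)
  finally have tD: "t * D < s" by simp
  define z where "z = segment_n d x y t"
  have z: "z \<in> S" "f z \<le> (1 - t) * f x + t * f y"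
    using conv x y t by (auto simp: convex_fun_n_def z_def)
  have diff: "z i - x i = t * (y i - x i)" if "i < d" for i
    using that by (simp add: z_def segment_n_def algebra_simps)
  have "dist_n d z x = sqrt (t\<^sup>2 * (\<Sum>i<d. (y i - x i)\<^sup>2))"
    by (simp add: dist_n_def norm_n_def diff power_mult_distrib sum_distrib_left)
  also have "\<dots> = t * D" using t by (simp add: D_def dist_n_def norm_n_def real_sqrt_mult)
  finally have dist: "dist_n d z x = t * D" .
  have inner: "inner_n d g (\<lambda>i. z i - x i) = t * inner_n d g (\<lambda>i. y i - x i)"
    by (simp add: inner_n_def diff sum_distrib_left mult_ac)
  have "\<bar>f z - f x - t * inner_n d g (\<lambda>i. y i - x i)\<bar> \<le> e / (D + 1) * (t * D)"
    using s(2)[OF z(1)] tD by (simp add: dist inner)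
  then have "t * inner_n d g (\<lambda>i. y i - x i) \<le> f z - f x + t * (e / (D + 1) * D)"
    by (simp add: mult_ac abs_le_iff)
  also have "f z - f x \<le> t * (f y - f x)" using z(2) by (simp add: algebra_simps)
  also have "t * (e / (D + 1) * D) \<le> t * e" using eD(2) t by (intro mult_left_mono) auto
  finally have "t * inner_n d g (\<lambda>i. y i - x i) \<le> t * (f y - f x + e)" by (simp add: algebra_simps)
  then show "inner_n d g (\<lambda>i. y i - x i) \<le> f y - f x + e" using t by simp
qed

text \<open>Adding the gradient inequalities at the two points cancels the values of
  \<open>f\<close>.\<close>

lemma convex_fun_n_radial_gradient_mono:
  assumes conv: "convex_fun_n d S f"
    and grad: "\<And>x. x \<in> S \<Longrightarrow> has_gradient_n d S f (g x) x"
    and S: "shift_n d x\<^sub>0 r \<eta> \<in> S" "shift_n d x\<^sub>0 \<rho> \<eta> \<in> S" and r: "r < \<rho>"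
  shows "inner_n d \<eta> (g (shift_n d x\<^sub>0 r \<eta>)) \<le> inner_n d \<eta> (g (shift_n d x\<^sub>0 \<rho> \<eta>))"
proof -
  let ?x = "shift_n d x\<^sub>0 r \<eta>" and ?y = "shift_n d x\<^sub>0 \<rho> \<eta>"
  have eq: "inner_n d h (\<lambda>i. ?y i - ?x i) = (\<rho> - r) * inner_n d \<eta> h"
    "inner_n d h (\<lambda>i. ?x i - ?y i) = - (\<rho> - r) * inner_n d \<eta> h" for h
    by (simp_all add: inner_n_def shift_n_def sum_distrib_left algebra_simps)
  have "(\<rho> - r) * inner_n d \<eta> (g ?x) \<le> f ?y - f ?x"
    using convex_fun_n_gradient_le[OF conv grad[OF S(1)] S] by (simp add: eq)
  moreover have "(r - \<rho>) * inner_n d \<eta> (g ?y) \<le> f ?x - f ?y"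
    using convex_fun_n_gradient_le[OF conv grad[OF S(2)] S(2,1)] by (simp add: eq)
  ultimately have "(\<rho> - r) * inner_n d \<eta> (g ?x) \<le> (\<rho> - r) * inner_n d \<eta> (g ?y)"
    by (simp add: algebra_simps)
  then show ?thesis using r by simp
qed

lemma polar_coordinates_n:
  assumes x: "x \<in> Rn d" and pos: "0 < dist_n d x x\<^sub>0"
  obtains \<eta> where "\<eta> \<in> sphere_n d" "x = shift_n d x\<^sub>0 (dist_n d x x\<^sub>0) \<eta>"
proof
  define \<rho> where "\<rho> = dist_n d x x\<^sub>0"
  define \<eta> where "\<eta> = (\<lambda>i\<in>{..<d}. (x i - x\<^sub>0 i) / \<rho>)"
  have "norm_n d \<eta> = sqrt ((\<Sum>i<d. (x i - x\<^sub>0 i)\<^sup>2) / \<rho>\<^sup>2)"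
    by (simp add: norm_n_def \<eta>_def power_divide sum_divide_distrib)
  also have "(\<Sum>i<d. (x i - x\<^sub>0 i)\<^sup>2) = \<rho>\<^sup>2"
    by (simp add: \<rho>_def dist_n_def norm_n_square)
  finally have "norm_n d \<eta> = 1" using pos by (simp add: \<rho>_def)
  moreover have "\<eta> \<in> Rn d" by (simp add: Rn_def restrict_PiE_iff \<eta>_def)
  ultimately show "\<eta> \<in> sphere_n d" by (simp add: sphere_n_def)
  show "x = shift_n d x\<^sub>0 (dist_n d x x\<^sub>0) \<eta>"
    using x pos by (auto simp: shift_n_def \<eta>_def \<rho>_def Rn_def fun_eq_iff PiE_iff extensional_def)
qed

subsection \<open>Z-estimators\<close>

context split_Z_estimation
begin

section \<open>Variance and moments of the score at \<open>\<theta>\<^sub>0\<close>\<close>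

lemma score_coordinate_measurable: "j < d \<Longrightarrow> (\<lambda>z. \<psi> z \<theta>\<^sub>0 j) \<in> borel_measurable P"
proof -
  assume j: "j < d"
  have "\<theta>\<^sub>0 \<in> space (restrict_space (borel_n d) \<Theta>)"
    using theta0_in Theta_sub by (auto simp: space_restrict_space borel_n_def space_PiM Rn_def)
  then have "(\<lambda>z. (z, \<theta>\<^sub>0)) \<in> measurable P (P \<Otimes>\<^sub>M restrict_space (borel_n d) \<Theta>)"
    by (intro measurable_Pair measurable_ident_sets[OF refl] measurable_const)
  from measurable_compose[OF this psi_measurable]
  have "(\<lambda>z. \<psi> z \<theta>\<^sub>0) \<in> measurable P (\<Pi>\<^sub>M i\<in>{..<d}. borel)"
    by (simp add: borel_n_def)
  from measurable_compose[OF this measurable_component_singleton] j show ?thesis by simp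
qed

lemma score_inner_measurable: "(\<lambda>z. inner_n d v (\<psi> z \<theta>\<^sub>0)) \<in> borel_measurable P"
  unfolding inner_n_def using score_coordinate_measurable by measurable

lemma score_product_integrable:
  assumes "i < d" "j < d"
  shows "integrable P (\<lambda>z. \<psi> z \<theta>\<^sub>0 i * \<psi> z \<theta>\<^sub>0 j)"
proof (rule Bochner_Integration.integrable_bound)
  show "integrable P (\<lambda>z. (\<psi> z \<theta>\<^sub>0 i)\<^sup>2 + (\<psi> z \<theta>\<^sub>0 j)\<^sup>2)"
    using assms psi_square_integrable by simp
  show "(\<lambda>z. \<psi> z \<theta>\<^sub>0 i * \<psi> z \<theta>\<^sub>0 j) \<in> borel_measurable P"
    using assms score_coordinate_measurable by simp
  have "\<bar>x * y\<bar> \<le> x\<^sup>2 + y\<^sup>2" for x y :: real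
  proof -
    have "0 \<le> \<bar>x\<bar> * \<bar>y\<bar>" "2 * (\<bar>x\<bar> * \<bar>y\<bar>) \<le> x\<^sup>2 + y\<^sup>2"
      using sum_squares_bound[of "\<bar>x\<bar>" "\<bar>y\<bar>"] by (simp_all add: mult.assoc)
    then show ?thesis unfolding abs_mult by linarith
  qed
  then show "AE z in P. norm (\<psi> z \<theta>\<^sub>0 i * \<psi> z \<theta>\<^sub>0 j) \<le> norm ((\<psi> z \<theta>\<^sub>0 i)\<^sup>2 + (\<psi> z \<theta>\<^sub>0 j)\<^sup>2)"
    by (intro AE_I2) simp
qed

lemma score_inner_square:
  "(inner_n d v (\<psi> z \<theta>\<^sub>0))\<^sup>2 = (\<Sum>i<d. \<Sum>j<d. v i * v j * (\<psi> z \<theta>\<^sub>0 i * \<psi> z \<theta>\<^sub>0 j))"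
  by (simp add: inner_n_def power2_eq_square sum_product mult_ac)

lemma score_inner_square_integrable: "integrable P (\<lambda>z. (inner_n d v (\<psi> z \<theta>\<^sub>0))\<^sup>2)"
  unfolding score_inner_square
  by (intro Bochner_Integration.integrable_sum integrable_mult_right score_product_integrable) auto

text \<open>The score at \<open>\<theta>\<^sub>0\<close> is centred, so its covariance is the second
  moment matrix and the Rayleigh bound applies.\<close>

lemma score_weak_variance:
  "(\<integral>z. (inner_n d v (\<psi> z \<theta>\<^sub>0))\<^sup>2 \<partial>P) \<le> lambda_max d (cov_psi P \<psi> \<theta>\<^sub>0) * (norm_n d v)\<^sup>2"
proof -
  have "(\<integral>z. (inner_n d v (\<psi> z \<theta>\<^sub>0))\<^sup>2 \<partial>P)
      = (\<Sum>i<d. \<integral>z. (\<Sum>j<d. v i * v j * (\<psi> z \<theta>\<^sub>0 i * \<psi> z \<theta>\<^sub>0 j)) \<partial>P)"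
    unfolding score_inner_square
    by (intro Bochner_Integration.integral_sum Bochner_Integration.integrable_sum
        integrable_mult_right score_product_integrable) auto
  also have "\<dots> = (\<Sum>i<d. \<Sum>j<d. \<integral>z. v i * v j * (\<psi> z \<theta>\<^sub>0 i * \<psi> z \<theta>\<^sub>0 j) \<partial>P)"
    by (intro sum.cong refl Bochner_Integration.integral_sum integrable_mult_right
        score_product_integrable) auto
  also have "\<dots> = (\<Sum>i<d. \<Sum>j<d. v i * v j * (\<integral>z. \<psi> z \<theta>\<^sub>0 i * \<psi> z \<theta>\<^sub>0 j \<partial>P))"
    by simp
  also have "\<dots> = (\<Sum>i<d. \<Sum>j<d. cov_psi P \<psi> \<theta>\<^sub>0 i j * v i * v j)"
    by (intro sum.cong refl) (simp add: cov_psi_def theta0_solves)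
  also have "\<dots> \<le> lambda_max d (cov_psi P \<psi> \<theta>\<^sub>0) * (norm_n d v)\<^sup>2"
    using dim_pos by (intro quadratic_form_le_lambda_max) (simp_all add: cov_psi_def mult.commute)
  finally show ?thesis .
qed

text \<open>A finite ratio forces a finite \<open>q\<close>-th moment, since \<open>Lp_norm\<close>
  is infinite for a non-integrable power. The second moment in the denominator is then replaced by
  its bound \<open>lam\<close>.\<close>

lemma score_moment_le:
  assumes lam: "lambda_max d (cov_psi P \<psi> \<theta>\<^sub>0) \<le> lam" and q: "2 < q"
    and L: "L_ratio d P \<psi> \<theta>\<^sub>0 q \<le> ereal \<kappa>" "0 \<le> \<kappa>" and v: "v \<in> sphere_n d"
  shows "integrable P (\<lambda>z. \<bar>inner_n d v (\<psi> z \<theta>\<^sub>0)\<bar> powr q)" (is "integrable P ?g")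
    and "(\<integral>z. \<bar>inner_n d v (\<psi> z \<theta>\<^sub>0)\<bar> powr q \<partial>P) \<le> (\<kappa> * sqrt lam) powr q"
proof -
  let ?f = "\<lambda>z. inner_n d v (\<psi> z \<theta>\<^sub>0)"
  define V where "V = (\<integral>z. (?f z)\<^sup>2 \<partial>P)"
  have norm_v: "norm_n d v = 1" using v by (simp add: sphere_n_def)
  have V: "0 \<le> V" "V \<le> lam" using score_weak_variance[of v] lam by (auto simp: V_def norm_v)
  have Lp2: "Lp_norm P 2 ?f = ereal (sqrt V)"
    using score_inner_square_integrable[of v] V by (simp add: Lp_norm_def V_def powr_half_sqrt)
  have "integrable P ?g \<and> integral\<^sup>L P ?g \<le> (\<kappa> * sqrt lam) powr q"
  proof (cases "V = 0")
    case True
    \<comment> \<open>Clearing the denominator is impossible here, but the projection vanishes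
      almost surely, and so does its \<open>q\<close>-th moment.\<close>
    then have "AE z in P. (?f z)\<^sup>2 = 0"
      using score_inner_square_integrable[of v]
      by (subst (asm) V_def, subst (asm) integral_nonneg_eq_0_iff_AE) auto
    then have AE0: "AE z in P. ?g z = 0" by simp
    have "integrable P ?g = integrable P (\<lambda>z. 0 :: real)"
      using AE0 score_inner_measurable by (intro integrable_cong_AE) auto
    moreover have "integral\<^sup>L P ?g = integral\<^sup>L P (\<lambda>z. 0 :: real)"
      using AE0 score_inner_measurable by (intro integral_cong_AE) auto
    ultimately show ?thesis by simp
  next
    case False
    then have V0: "0 < V" using V by simp
    have "Lp_norm P q ?f / Lp_norm P 2 ?f \<le> L_ratio d P \<psi> \<theta>\<^sub>0 q"
      unfolding L_ratio_def using v by (rule SUP_upper)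
    also note L(1)
    finally have "Lp_norm P q ?f / ereal (sqrt V) \<le> ereal \<kappa>" by (simp only: Lp2)
    then have le: "Lp_norm P q ?f \<le> ereal (\<kappa> * sqrt V)"
      using V0 by (simp add: ereal_divide_le_pos mult.commute)
    then have int: "integrable P ?g" by (auto simp: Lp_norm_def split: if_splits)
    with le have "(integral\<^sup>L P ?g) powr (1 / q) \<le> \<kappa> * sqrt V" by (simp add: Lp_norm_def)
    also have "\<dots> \<le> \<kappa> * sqrt lam" using V L by (intro mult_left_mono) auto
    finally have "((integral\<^sup>L P ?g) powr (1 / q)) powr q \<le> (\<kappa> * sqrt lam) powr q"
      using q by (intro powr_mono2) auto
    then show ?thesis using int q by (simp add: powr_powr)
  qed
  then show "integrable P ?g" "integral\<^sup>L P ?g \<le> (\<kappa> * sqrt lam) powr q" by blast+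
qed

text \<open>Each coordinate is a projection on a unit vector. The power mean inequality combines the
  \<open>d\<close> coordinate moments with the factor \<open>d powr (q / 2)\<close>, the
  \<open>q\<close>-th power of \<open>sqrt d\<close>.\<close>

lemma score_centred_vector:
  assumes lam: "lambda_max d (cov_psi P \<psi> \<theta>\<^sub>0) \<le> lam" "0 \<le> lam" and q: "2 < q"
    and L: "L_ratio d P \<psi> \<theta>\<^sub>0 q \<le> ereal \<kappa>" "0 \<le> \<kappa>"
  shows "centred_vector P d (\<lambda>z. \<psi> z \<theta>\<^sub>0) lam q ((sqrt (real d) * \<kappa> * sqrt lam) powr q)"
proof -
  interpret prob_space P by (rule prob_P)
  have coord: "integrable P (\<lambda>z. \<bar>\<psi> z \<theta>\<^sub>0 j\<bar> powr q)"
    "(\<integral>z. \<bar>\<psi> z \<theta>\<^sub>0 j\<bar> powr q \<partial>P) \<le> (\<kappa> * sqrt lam) powr q" if j: "j < d" for j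
  proof -
    define e where "e = (\<lambda>i\<in>{..<d}. if i = j then 1 else 0 :: real)"
    have "norm_n d e = 1"
      using j by (simp add: norm_n_def e_def if_distrib[of "\<lambda>x. x\<^sup>2"] cong: if_cong)
    then have "e \<in> sphere_n d" by (simp add: sphere_n_def Rn_def e_def restrict_PiE_iff)
    moreover have "inner_n d e x = x j" for x
      using j by (simp add: inner_n_def e_def if_distrib[of "\<lambda>x. x * _"] cong: if_cong)
    ultimately show "integrable P (\<lambda>z. \<bar>\<psi> z \<theta>\<^sub>0 j\<bar> powr q)"
      "(\<integral>z. \<bar>\<psi> z \<theta>\<^sub>0 j\<bar> powr q \<partial>P) \<le> (\<kappa> * sqrt lam) powr q"
      using score_moment_le[OF lam(1) q L, of e] by simp_all
  qed
  let ?n = "\<lambda>z. norm_n d (\<psi> z \<theta>\<^sub>0) powr q"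
  let ?b = "\<lambda>z. real d powr (q / 2 - 1) * (\<Sum>j<d. \<bar>\<psi> z \<theta>\<^sub>0 j\<bar> powr q)"
  have le: "?n z \<le> ?b z" for z
    using dim_pos q by (intro norm_n_powr_le) auto
  have meas: "?n \<in> borel_measurable P"
    unfolding norm_n_def using score_coordinate_measurable by measurable
  have b_int: "integrable P ?b" using coord(1) by auto
  have n_int: "integrable P ?n"
    using le by (intro Bochner_Integration.integrable_bound[OF b_int meas] AE_I2)
      (simp add: order.trans[OF le abs_ge_self])
  have "integral\<^sup>L P ?n \<le> integral\<^sup>L P ?b"
    using le by (intro integral_mono n_int b_int)
  also have "\<dots> = real d powr (q / 2 - 1) * (\<Sum>j<d. \<integral>z. \<bar>\<psi> z \<theta>\<^sub>0 j\<bar> powr q \<partial>P)"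
    using coord(1) by simp
  also have "\<dots> \<le> real d powr (q / 2 - 1) * (\<Sum>j<d. (\<kappa> * sqrt lam) powr q)"
    using coord(2) by (intro mult_left_mono sum_mono) auto
  also have "\<dots> = real d powr (q / 2) * (\<kappa> * sqrt lam) powr q"
    using dim_pos by (simp add: powr_diff)
  also have "real d powr (q / 2) = sqrt (real d) powr q"
    using square_powr_half[of "sqrt (real d)" q] by simp
  also have "sqrt (real d) powr q * (\<kappa> * sqrt lam) powr q = (sqrt (real d) * \<kappa> * sqrt lam) powr q"
    using L lam by (simp add: powr_mult mult.assoc)
  finally have moment: "integral\<^sup>L P ?n \<le> (sqrt (real d) * \<kappa> * sqrt lam) powr q" .
  show ?thesis
  proof
    show "(\<integral>z. (inner_n d v (\<psi> z \<theta>\<^sub>0))\<^sup>2 \<partial>P) \<le> lam" if v: "norm_n d v \<le> 1" for v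
    proof -
      have "lambda_max d (cov_psi P \<psi> \<theta>\<^sub>0) * (norm_n d v)\<^sup>2 \<le> lam * (norm_n d v)\<^sup>2"
        using lam by (intro mult_right_mono) auto
      also have "\<dots> \<le> lam * 1"
        using lam v by (intro mult_left_mono) (auto simp: power_le_one)
      finally show ?thesis using score_weak_variance[of v] by simp
    qed
  qed (use score_coordinate_measurable psi_square_integrable theta0_solves q n_int moment
      in \<open>auto simp: mean_psi_def\<close>)
qed

text \<open>Independence and the common law make the subsample a draw from the product measure, to
  which probabilities of data events are transferred.\<close>

lemma subsample_measurable: "subsample Z I\<^sub>1 \<in> measurable M (\<Pi>\<^sub>M i\<in>I\<^sub>1. P)"
  and subsample_distr: "distr M (\<Pi>\<^sub>M i\<in>I\<^sub>1. P) (subsample Z I\<^sub>1) = (\<Pi>\<^sub>M i\<in>I\<^sub>1. P)"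
  and finite_I1: "finite I\<^sub>1" and I1_nonempty: "I\<^sub>1 \<noteq> {}"
proof -
  interpret M: prob_space M by (rule prob_M)
  have sub: "I\<^sub>1 \<subseteq> {1..n}" using partition by auto
  then show "finite I\<^sub>1" by (rule finite_subset) simp
  have "0 < n div 2" using n_pos n_even by (auto elim: evenE)
  then show ne: "I\<^sub>1 \<noteq> {}" using partition(3) by force
  have indep: "M.indep_vars (\<lambda>_. P) Z I\<^sub>1" by (rule M.indep_vars_subset[OF indep_Z sub])
  have Z: "Z i \<in> measurable M P" if "i \<in> I\<^sub>1" for i
    using indep that by (auto simp: M.indep_vars_def)
  have eq: "subsample Z I\<^sub>1 = (\<lambda>\<omega>. \<lambda>i\<in>I\<^sub>1. Z i \<omega>)" by (simp add: subsample_def fun_eq_iff)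
  show "subsample Z I\<^sub>1 \<in> measurable M (\<Pi>\<^sub>M i\<in>I\<^sub>1. P)"
    unfolding eq by (intro measurable_restrict Z)
  have "distr M (\<Pi>\<^sub>M i\<in>I\<^sub>1. P) (subsample Z I\<^sub>1) = (\<Pi>\<^sub>M i\<in>I\<^sub>1. distr M P (Z i))"
    unfolding eq using M.indep_vars_iff_distr_eq_PiM'[OF ne, where M' = "\<lambda>_. P" and X = Z] Z indep by simp
  also have "\<dots> = (\<Pi>\<^sub>M i\<in>I\<^sub>1. P)"
    using distr_Z sub by (intro PiM_cong) auto
  finally show "distr M (\<Pi>\<^sub>M i\<in>I\<^sub>1. P) (subsample Z I\<^sub>1) = (\<Pi>\<^sub>M i\<in>I\<^sub>1. P)" .
qed

text \<open>The Fuk--Nagaev bound, rescaled from sums over \<open>N = n / 2\<close> indices to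
  averages. \<open>\<kappa> > 0\<close> makes the moment parameter \<open>m\<close> strictly
  positive, as that bound requires.\<close>

lemma score_average_tail:
  assumes lam: "lambda_max d (cov_psi P \<psi> \<theta>\<^sub>0) \<le> lam" "0 < lam" and q: "2 < q"
    and L: "L_ratio d P \<psi> \<theta>\<^sub>0 q \<le> ereal \<kappa>" "0 < \<kappa>" and eps: "0 < \<epsilon>" "\<epsilon> < 1"
  defines "c \<equiv> 2 * (22 + 4 * q * exp q) * sqrt lam *
      (sqrt ((real d + ln (2 / \<epsilon>)) / real n)
        + \<kappa> * sqrt (real d) / (real n powr (1 - 1 / q) * \<epsilon> powr (1 / q)))"
  shows "{\<omega> \<in> space M. c < norm_n d (avg_psi \<psi> I\<^sub>1 (subsample Z I\<^sub>1 \<omega>) \<theta>\<^sub>0)} \<in> sets M" (is "?F \<in> _")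
    and "emeasure M {\<omega> \<in> space M. c < norm_n d (avg_psi \<psi> I\<^sub>1 (subsample Z I\<^sub>1 \<omega>) \<theta>\<^sub>0)} \<le> ennreal \<epsilon>"
proof -
  define m where "m = (sqrt (real d) * \<kappa> * sqrt lam) powr q"
  interpret X: centred_vector P d "\<lambda>z. \<psi> z \<theta>\<^sub>0" lam q m
    unfolding m_def using lam L by (intro score_centred_vector q) auto
  define N where "N = real (card I\<^sub>1)"
  have n: "0 < real n" using n_pos by simp
  have N: "N = real n / 2" using partition(3) n_even by (simp add: N_def real_of_nat_div)
  let ?Q = "\<Pi>\<^sub>M i\<in>I\<^sub>1. P"
  define G where "G = {D \<in> space ?Q. c * N < norm_n d (\<lambda>j. \<Sum>i\<in>I\<^sub>1. \<psi> (D i) \<theta>\<^sub>0 j)}"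
  have G: "G \<in> sets ?Q"
    unfolding G_def using X.norm_sum_measurable[of I\<^sub>1] by measurable
  have avg: "norm_n d (avg_psi \<psi> I\<^sub>1 D \<theta>\<^sub>0) = norm_n d (\<lambda>j. \<Sum>i\<in>I\<^sub>1. \<psi> (D i) \<theta>\<^sub>0 j) / N" for D
    using N n by (simp add: avg_psi_def N_def[symmetric] norm_n_def power_divide
        sum_divide_distrib[symmetric] real_sqrt_divide)
  have F: "?F = subsample Z I\<^sub>1 -` G \<inter> space M"
    using measurable_space[OF subsample_measurable] N n by (auto simp: G_def avg field_simps)
  then show "?F \<in> sets M" using subsample_measurable G by (simp add: measurable_sets)
  have "emeasure M ?F = emeasure (distr M ?Q (subsample Z I\<^sub>1)) G"
    using subsample_measurable G by (simp add: F emeasure_distr)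
  also have "\<dots> = emeasure ?Q G" by (simp only: subsample_distr)
  also have "\<dots> \<le> emeasure ?Q {D \<in> space ?Q. (22 + 4 * q * exp q) *
        (sqrt (N * lam * (real d + ln (2 / \<epsilon>))) + (2 * N * m / \<epsilon>) powr (1 / q))
        < norm_n d (\<lambda>j. \<Sum>i\<in>I\<^sub>1. \<psi> (D i) \<theta>\<^sub>0 j)}" (is "_ \<le> emeasure ?Q ?H")
  proof (rule emeasure_mono)
    define x where "x = ln (2 / \<epsilon>)"
    have "0 \<le> x" using eps by (simp add: x_def field_simps)
    \<comment> \<open>Since \<open>2 * N = n\<close>, a factor \<open>n\<close> can be pulled out,
      which leaves the exponent \<open>1 - 1 / q\<close> in the denominator.\<close>
    have "(2 * N * m / \<epsilon>) powr (1 / q) = real n powr (1 / q) * (sqrt (real d) * \<kappa> * sqrt lam) / \<epsilon> powr (1 / q)"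
      using n eps L lam q by (simp add: N m_def powr_divide powr_mult powr_powr)
    also have "real n powr (1 / q) = real n / real n powr (1 - 1 / q)"
      using n by (simp add: powr_diff)
    finally have B: "(2 * N * m / \<epsilon>) powr (1 / q)
        = 2 * N * sqrt lam * (\<kappa> * sqrt (real d) / (real n powr (1 - 1 / q) * \<epsilon> powr (1 / q)))"
      by (simp add: N mult_ac)
    \<comment> \<open>Doubling \<open>N\<close> inside the root gives \<open>n\<close>, so both
      terms acquire the common factor \<open>n * sqrt lam\<close>.\<close>
    have "sqrt (N * lam * (real d + x)) \<le> sqrt (2 * N * lam * (real d + x))"
      using \<open>0 \<le> x\<close> N n lam by simp
    also have "2 * N * lam * (real d + x) = (real n * sqrt lam)\<^sup>2 * ((real d + x) / real n)"
      using n lam by (simp add: N power_mult_distrib power2_eq_square)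
    also have "sqrt \<dots> = 2 * N * sqrt lam * sqrt ((real d + x) / real n)"
      unfolding real_sqrt_mult using n lam by (simp add: N)
    finally have "(22 + 4 * q * exp q) * (sqrt (N * lam * (real d + x)) + (2 * N * m / \<epsilon>) powr (1 / q))
      \<le> (22 + 4 * q * exp q) * (2 * N * sqrt lam * sqrt ((real d + x) / real n)
        + 2 * N * sqrt lam * (\<kappa> * sqrt (real d) / (real n powr (1 - 1 / q) * \<epsilon> powr (1 / q))))"
      unfolding B using q by (intro mult_left_mono add_right_mono) auto
    also have "\<dots> = c * N"
    proof -
      have "K * (2 * N * t * a + 2 * N * t * b) = 2 * K * t * (a + b) * N" for K t a b :: real
        by (simp add: algebra_simps)
      then show ?thesis unfolding c_def x_def by blast
    qed
    finally show "G \<subseteq> ?H" by (auto simp: G_def x_def)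
    show "?H \<in> sets ?Q" using X.norm_sum_measurable[of I\<^sub>1] by measurable
  qed
  also have "\<dots> \<le> ennreal \<epsilon>"
    unfolding N_def using dim_pos L lam eps finite_I1 I1_nonempty
    by (intro X.fuk_nagaev) (auto simp: m_def)
  finally show "emeasure M ?F \<le> ennreal \<epsilon>" .
qed

section \<open>From the score at a fixed radius to the location of the estimator\<close>

lemma inner_avg_psi:
  "inner_n d \<eta> (avg_psi \<psi> I D \<theta>) = (\<Sum>i\<in>I. inner_n d \<eta> (\<psi> (D i) \<theta>)) / real (card I)"
proof -
  have "(\<Sum>i\<in>I. inner_n d \<eta> (\<psi> (D i) \<theta>)) = (\<Sum>j<d. \<Sum>i\<in>I. \<eta> j * \<psi> (D i) \<theta> j)"
    unfolding inner_n_def by (rule sum.swap)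
  then show ?thesis
    by (simp add: inner_n_def avg_psi_def sum_divide_distrib sum_distrib_left)
qed

text \<open>\<open>\<eta>\<close> is the direction from \<open>\<theta>\<^sub>0\<close> to the
  estimator, where the average score vanishes. Radial monotonicity holds for each data point and
  passes to the average.\<close>

lemma score_nonpos_towards_estimator:
  assumes convex: "\<forall>z\<in>space P. convex_fun_n d \<Theta> (L z) \<and> (\<forall>\<theta>\<in>\<Theta>. has_gradient_n d \<Theta> (L z) (\<psi> z \<theta>) \<theta>)"
    and D: "D \<in> space (\<Pi>\<^sub>M i\<in>I\<^sub>1. P)" and r: "0 < r" "r < dist_n d (T D) \<theta>\<^sub>0"
    and ray: "\<And>\<eta>. \<eta> \<in> sphere_n d \<Longrightarrow> shift_n d \<theta>\<^sub>0 r \<eta> \<in> \<Theta>"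
  obtains \<eta> where "\<eta> \<in> sphere_n d" "inner_n d \<eta> (avg_psi \<psi> I\<^sub>1 D (shift_n d \<theta>\<^sub>0 r \<eta>)) \<le> 0"
proof -
  have T: "T D \<in> \<Theta>" by (rule T_in[OF D])
  have "T D \<in> Rn d" using T Theta_sub by auto
  moreover have "0 < dist_n d (T D) \<theta>\<^sub>0" using r by simp
  ultimately obtain \<eta> where eta: "\<eta> \<in> sphere_n d" "T D = shift_n d \<theta>\<^sub>0 (dist_n d (T D) \<theta>\<^sub>0) \<eta>"
    by (rule polar_coordinates_n)
  have "inner_n d \<eta> (\<psi> (D i) (shift_n d \<theta>\<^sub>0 r \<eta>)) \<le> inner_n d \<eta> (\<psi> (D i) (T D))" if "i \<in> I\<^sub>1" for i
  proof -
    have Di: "D i \<in> space P" using D that by (auto simp: space_PiM)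
    show ?thesis
      using convex_fun_n_radial_gradient_mono[of d \<Theta> "L (D i)" "\<psi> (D i)" \<theta>\<^sub>0 r \<eta> "dist_n d (T D) \<theta>\<^sub>0"]
        convex Di ray[OF eta(1)] T r eta(2)[symmetric] by simp
  qed
  then have "inner_n d \<eta> (avg_psi \<psi> I\<^sub>1 D (shift_n d \<theta>\<^sub>0 r \<eta>)) \<le> inner_n d \<eta> (avg_psi \<psi> I\<^sub>1 D (T D))"
    unfolding inner_avg_psi by (intro divide_right_mono sum_mono) auto
  also have "\<dots> = 0" using T_solves[OF D] by (simp add: inner_n_def)
  finally show ?thesis using eta(1) that by blast
qed

text \<open>Positive dimension makes the sphere nonempty; the supremum over an empty set would be
  minus infinity.\<close>

lemma L_ratio_nonneg: "0 \<le> L_ratio d P \<psi> \<theta>\<^sub>0 q"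
proof -
  define e where "e = (\<lambda>i\<in>{..<d}. if i = 0 then 1 else 0 :: real)"
  have "norm_n d e = 1"
    using dim_pos by (simp add: norm_n_def e_def if_distrib[of "\<lambda>x. x\<^sup>2"] cong: if_cong)
  then have "e \<in> sphere_n d" by (simp add: sphere_n_def Rn_def e_def restrict_PiE_iff)
  moreover have nonneg: "0 \<le> Lp_norm P p f" for p f by (simp add: Lp_norm_def)
  have "0 \<le> a / b" if "0 \<le> a" "0 \<le> b" for a b :: ereal
    using that by (simp add: divide_ereal_def ereal_0_le_mult ereal_inverse_nonneg_iff)
  ultimately show ?thesis
    unfolding L_ratio_def using nonneg by (intro SUP_upper2[of e]) auto
qed

text \<open>Everything happens at one radius \<open>r\<close>, so only the values
  \<open>\<mu>r\<close> and \<open>ur\<close> of the two bounding functions appear.\<close>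

lemma estimator_tail:
  assumes lam: "lambda_max d (cov_psi P \<psi> \<theta>\<^sub>0) \<le> lam" "0 < lam" and q: "2 < q"
    and convex: "\<forall>z\<in>space P. convex_fun_n d \<Theta> (L z) \<and> (\<forall>\<theta>\<in>\<Theta>. has_gradient_n d \<Theta> (L z) (\<psi> z \<theta>) \<theta>)"
    and r: "0 < r" and ray: "\<And>\<eta>. \<eta> \<in> sphere_n d \<Longrightarrow> shift_n d \<theta>\<^sub>0 r \<eta> \<in> \<Theta>"
    and \<mu>: "\<And>\<eta>. \<eta> \<in> sphere_n d \<Longrightarrow> \<mu>r \<le> inner_n d \<eta> (mean_psi P \<psi> (shift_n d \<theta>\<^sub>0 r \<eta>))"
    and eps: "0 < \<epsilon>" "\<epsilon> < 1"
    and process: "outer_measure_of M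
           {\<omega> \<in> space M.
              ereal (sqrt (real n / 2)) *
                (SUP \<eta>\<in>sphere_n d. ereal (- inner_n d \<eta> (\<lambda>j.
                   avg_psi \<psi> I\<^sub>1 (subsample Z I\<^sub>1 \<omega>) (shift_n d \<theta>\<^sub>0 r \<eta>) j
                   - mean_psi P \<psi> (shift_n d \<theta>\<^sub>0 r \<eta>) j
                   - avg_psi \<psi> I\<^sub>1 (subsample Z I\<^sub>1 \<omega>) \<theta>\<^sub>0 j)))
              \<ge> ereal ur} \<le> ennreal \<epsilon>" (is "outer_measure_of M ?E \<le> _")
    and radius: "ereal \<mu>r >
           ereal (ur / sqrt (real n / 2)) +
           ereal (2 * (22 + 4 * q * exp q) / sqrt lam * lam) *
             (ereal (sqrt ((real d + ln (2 / \<epsilon>)) / real n)) +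
              L_ratio d P \<psi> \<theta>\<^sub>0 q * ereal (sqrt (real d)) /
                ereal (real n powr (1 - 1 / q) * \<epsilon> powr (1 / q)))"
  shows "measure M {\<omega> \<in> space M. dist_n d (T (subsample Z I\<^sub>1 \<omega>)) \<theta>\<^sub>0 > r} \<le> 2 * \<epsilon>" (is "measure M ?A \<le> _")
proof -
  interpret M: prob_space M by (rule prob_M)
  define C where "C = 2 * (22 + 4 * q * exp q) * sqrt lam"
  define b where "b = sqrt ((real d + ln (2 / \<epsilon>)) / real n)"
  define w where "w = real n powr (1 - 1 / q) * \<epsilon> powr (1 / q)"
  have n: "0 < real n" using n_pos by simp
  have C: "0 < C" "2 * (22 + 4 * q * exp q) / sqrt lam * lam = C"
  proof -
    have "0 < 22 + 4 * q * exp q" using q by (intro add_pos_nonneg) auto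
    then show "0 < C" using lam by (simp add: C_def)
    have "x / sqrt lam * lam = x * (lam / sqrt lam)" for x by simp
    then show "2 * (22 + 4 * q * exp q) / sqrt lam * lam = C"
      using lam unfolding C_def by (simp only: real_div_sqrt less_imp_le)
  qed
  have w: "0 < w" using n eps by (simp add: w_def)
  have sd: "0 < sqrt (real d)" using dim_pos by simp
  \<comment> \<open>An infinite ratio would make the right side of the radius condition infinite,
    against its real left side.\<close>
  obtain k where k: "0 \<le> k" "L_ratio d P \<psi> \<theta>\<^sub>0 q = ereal k"
  proof (cases "L_ratio d P \<psi> \<theta>\<^sub>0 q")
    case PInf
    then show ?thesis using radius C w sd by (simp add: w_def[symmetric])
  qed (use L_ratio_nonneg[of q] in \<open>auto intro: that\<close>)
  have gap: "ur / sqrt (real n / 2) + C * (b + k * sqrt (real d) / w) < \<mu>r"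
    using radius unfolding C(2) b_def[symmetric] w_def[symmetric] k(2) using w by simp
  define g where "g = \<mu>r - (ur / sqrt (real n / 2) + C * (b + k * sqrt (real d) / w))"
  \<comment> \<open>\<open>k\<close> may be 0, whereas the tail bound takes a positive bound on the
    ratio. Spending the whole gap \<open>g\<close> on \<open>\<kappa>\<close> also makes
    \<open>\<mu>r - c\<close> equal to the rescaled process threshold.\<close>
  define \<kappa> where "\<kappa> = k + g * w / (C * sqrt (real d))"
  define c where "c = C * (b + \<kappa> * sqrt (real d) / w)"
  have "0 < g" using gap by (simp add: g_def)
  then have "0 < g * w / (C * sqrt (real d))"
    using C(1) w sd by (intro divide_pos_pos mult_pos_pos)
  then have kappa: "0 < \<kappa>" "k \<le> \<kappa>" using k by (simp_all add: \<kappa>_def)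
  have "c = C * (b + k * sqrt (real d) / w) + g"
    using C(1) w sd by (simp add: c_def \<kappa>_def field_simps)
  then have c: "\<mu>r - c = ur / sqrt (real n / 2)" by (simp add: g_def)
  have L: "L_ratio d P \<psi> \<theta>\<^sub>0 q \<le> ereal \<kappa>" using k kappa by simp
  let ?F = "{\<omega> \<in> space M. c < norm_n d (avg_psi \<psi> I\<^sub>1 (subsample Z I\<^sub>1 \<omega>) \<theta>\<^sub>0)}"
  have F: "?F \<in> sets M" "emeasure M ?F \<le> ennreal \<epsilon>"
    using score_average_tail[OF lam q L kappa(1) eps] unfolding c_def C_def b_def w_def .
  have sub: "?A \<subseteq> ?E \<union> ?F"
  proof
    fix \<omega> assume A: "\<omega> \<in> ?A"
    let ?D = "subsample Z I\<^sub>1 \<omega>"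
    show "\<omega> \<in> ?E \<union> ?F"
    proof (cases "\<omega> \<in> ?F")
      case False
      then have small: "norm_n d (avg_psi \<psi> I\<^sub>1 ?D \<theta>\<^sub>0) \<le> c" using A by auto
      have D: "?D \<in> space (\<Pi>\<^sub>M i\<in>I\<^sub>1. P)"
        using A measurable_space[OF subsample_measurable] by auto
      obtain \<eta> where eta: "\<eta> \<in> sphere_n d" "inner_n d \<eta> (avg_psi \<psi> I\<^sub>1 ?D (shift_n d \<theta>\<^sub>0 r \<eta>)) \<le> 0"
        using score_nonpos_towards_estimator[OF convex D r _ ray] A by auto
      let ?v = "\<lambda>\<eta>. - inner_n d \<eta> (\<lambda>j. avg_psi \<psi> I\<^sub>1 ?D (shift_n d \<theta>\<^sub>0 r \<eta>) j
                   - mean_psi P \<psi> (shift_n d \<theta>\<^sub>0 r \<eta>) j - avg_psi \<psi> I\<^sub>1 ?D \<theta>\<^sub>0 j)"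
      have "\<bar>inner_n d \<eta> (avg_psi \<psi> I\<^sub>1 ?D \<theta>\<^sub>0)\<bar> \<le> 1 * norm_n d (avg_psi \<psi> I\<^sub>1 ?D \<theta>\<^sub>0)"
        using inner_n_le_norm[of d \<eta>] eta(1) by (simp add: sphere_n_def)
      moreover have "?v \<eta> = - inner_n d \<eta> (avg_psi \<psi> I\<^sub>1 ?D (shift_n d \<theta>\<^sub>0 r \<eta>))
          + inner_n d \<eta> (mean_psi P \<psi> (shift_n d \<theta>\<^sub>0 r \<eta>)) + inner_n d \<eta> (avg_psi \<psi> I\<^sub>1 ?D \<theta>\<^sub>0)"
        by (simp add: inner_n_def right_diff_distrib sum_subtractf)
      ultimately have "\<mu>r - c \<le> ?v \<eta>"
        using eta(2) \<mu>[OF eta(1)] small by linarith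
      then have "ur \<le> sqrt (real n / 2) * ?v \<eta>"
        unfolding c using n by (simp add: pos_divide_le_eq mult.commute)
      then have "ereal ur \<le> ereal (sqrt (real n / 2)) * ereal (?v \<eta>)" by simp
      also have "\<dots> \<le> ereal (sqrt (real n / 2)) * (SUP \<eta>\<in>sphere_n d. ereal (?v \<eta>))"
        using eta(1) by (intro ereal_mult_left_mono SUP_upper) auto
      finally show ?thesis using A by blast
    qed simp
  qed
  \<comment> \<open>\<open>process\<close> bounds an outer measure, so \<open>?E\<close> is covered
    by a measurable set of the same measure. For a non-measurable \<open>?A\<close> the value of
    \<open>measure\<close> is 0 by convention.\<close>
  show ?thesis
  proof (cases "?A \<in> sets M")
    case True
    have "?E \<subseteq> space M" by blast
    from outer_measure_of_attain[OF this]
    obtain E' where E': "E' \<in> sets M" "?E \<subseteq> E'" "outer_measure_of M ?E = emeasure M E'"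
      by blast
    have "emeasure M ?A \<le> emeasure M (E' \<union> ?F)"
      using sub E' F by (intro emeasure_mono) auto
    also have "\<dots> \<le> emeasure M E' + emeasure M ?F"
      using E' F by (intro emeasure_subadditive) auto
    also have "\<dots> \<le> ennreal \<epsilon> + ennreal \<epsilon>"
      using process unfolding E'(3) by (rule add_mono[OF _ F(2)])
    also have "\<dots> = ennreal (2 * \<epsilon>)" using eps by (simp flip: ennreal_plus)
    finally show ?thesis using eps by (simp add: M.emeasure_eq_measure)
  qed (use eps in \<open>simp add: measure_notin_sets\<close>)
qed

end

theorem theorem4:
  fixes q lam :: real
  assumes "q > 2" and "lam > 0"
  shows "\<exists>C::real. C > 0 \<and>
    (\<forall>d n (P :: 'z measure) \<Theta> \<psi> \<theta>\<^sub>0 (M :: 'w measure) Z I\<^sub>1 I\<^sub>2 T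
       (L :: 'z \<Rightarrow> rvec \<Rightarrow> real) (\<delta>\<^sub>0::real) (\<mu>low :: real \<Rightarrow> real) (u :: real \<Rightarrow> real \<Rightarrow> real).
      split_Z_estimation d n P \<Theta> \<psi> \<theta>\<^sub>0 M Z I\<^sub>1 I\<^sub>2 T \<longrightarrow>
      lambda_max d (cov_psi P \<psi> \<theta>\<^sub>0) \<le> lam \<longrightarrow>
      (\<forall>z\<in>space P. convex_fun_n d \<Theta> (L z) \<and> (\<forall>\<theta>\<in>\<Theta>. has_gradient_n d \<Theta> (L z) (\<psi> z \<theta>) \<theta>)) \<longrightarrow>
      \<delta>\<^sub>0 > 0 \<longrightarrow>
      (\<forall>\<delta>\<in>{0<..<\<delta>\<^sub>0}. \<forall>\<eta>\<in>sphere_n d. shift_n d \<theta>\<^sub>0 \<delta> \<eta> \<in> \<Theta>) \<longrightarrow>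
      mono_on {0<..<\<delta>\<^sub>0} \<mu>low \<longrightarrow>
      (\<forall>\<delta>\<in>{0<..<\<delta>\<^sub>0}. 0 \<le> \<mu>low \<delta> \<and>
         ereal (\<mu>low \<delta>) \<le>
           (INF \<eta>\<in>sphere_n d. ereal (inner_n d \<eta> (mean_psi P \<psi> (shift_n d \<theta>\<^sub>0 \<delta> \<eta>))))) \<longrightarrow>
      (\<forall>\<delta>\<in>{0<..<\<delta>\<^sub>0}. \<forall>\<epsilon>\<in>{0<..<1}. 0 \<le> u \<delta> \<epsilon> \<and>
         outer_measure_of M
           {\<omega> \<in> space M.
              ereal (sqrt (real n / 2)) *
                (SUP \<eta>\<in>sphere_n d. ereal (- inner_n d \<eta> (\<lambda>j.
                   avg_psi \<psi> I\<^sub>1 (subsample Z I\<^sub>1 \<omega>) (shift_n d \<theta>\<^sub>0 \<delta> \<eta>) j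
                   - mean_psi P \<psi> (shift_n d \<theta>\<^sub>0 \<delta> \<eta>) j
                   - avg_psi \<psi> I\<^sub>1 (subsample Z I\<^sub>1 \<omega>) \<theta>\<^sub>0 j)))
              \<ge> ereal (u \<delta> \<epsilon>)}
         \<le> ennreal \<epsilon>) \<longrightarrow>
      (\<forall>\<epsilon>\<in>{0<..<1}. \<forall>r\<in>{0<..<\<delta>\<^sub>0}.
         ereal (\<mu>low r) >
           ereal (u r \<epsilon> / sqrt (real n / 2)) +
           ereal (C * lam) *
             (ereal (sqrt ((real d + ln (2 / \<epsilon>)) / real n)) +
              L_ratio d P \<psi> \<theta>\<^sub>0 q * ereal (sqrt (real d)) /
                ereal (real n powr (1 - 1 / q) * \<epsilon> powr (1 / q))) \<longrightarrow>
         measure M {\<omega> \<in> space M. dist_n d (T (subsample Z I\<^sub>1 \<omega>)) \<theta>\<^sub>0 > r} \<le> 2 * \<epsilon>))"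
proof (intro exI conjI allI impI ballI)
  \<comment> \<open>The witness depends on \<open>q\<close> and \<open>lam\<close> only. Dividing by
    \<open>sqrt lam\<close> turns its product with \<open>lam\<close> into a multiple of
    \<open>sqrt lam\<close>, the scale of the score.\<close>
  show "0 < 2 * (22 + 4 * q * exp q) / sqrt lam"
    using assms by (intro divide_pos_pos mult_pos_pos add_pos_nonneg) auto
next
  fix d n and P :: "'z measure" and \<Theta> \<psi> \<theta>\<^sub>0 and M :: "'w measure" and Z I\<^sub>1 I\<^sub>2 T
    and L :: "'z \<Rightarrow> rvec \<Rightarrow> real" and \<delta>\<^sub>0 :: real and \<mu>low :: "real \<Rightarrow> real" and u :: "real \<Rightarrow> real \<Rightarrow> real"
    and \<epsilon> r :: real
  assume est: "split_Z_estimation d n P \<Theta> \<psi> \<theta>\<^sub>0 M Z I\<^sub>1 I\<^sub>2 T"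
    and lam: "lambda_max d (cov_psi P \<psi> \<theta>\<^sub>0) \<le> lam"
    and convex: "\<forall>z\<in>space P. convex_fun_n d \<Theta> (L z) \<and> (\<forall>\<theta>\<in>\<Theta>. has_gradient_n d \<Theta> (L z) (\<psi> z \<theta>) \<theta>)"
    and ray: "\<forall>\<delta>\<in>{0<..<\<delta>\<^sub>0}. \<forall>\<eta>\<in>sphere_n d. shift_n d \<theta>\<^sub>0 \<delta> \<eta> \<in> \<Theta>"
    and \<mu>: "\<forall>\<delta>\<in>{0<..<\<delta>\<^sub>0}. 0 \<le> \<mu>low \<delta> \<and>
         ereal (\<mu>low \<delta>) \<le>
           (INF \<eta>\<in>sphere_n d. ereal (inner_n d \<eta> (mean_psi P \<psi> (shift_n d \<theta>\<^sub>0 \<delta> \<eta>))))"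
    and process: "\<forall>\<delta>\<in>{0<..<\<delta>\<^sub>0}. \<forall>\<epsilon>\<in>{0<..<1}. 0 \<le> u \<delta> \<epsilon> \<and>
         outer_measure_of M
           {\<omega> \<in> space M.
              ereal (sqrt (real n / 2)) *
                (SUP \<eta>\<in>sphere_n d. ereal (- inner_n d \<eta> (\<lambda>j.
                   avg_psi \<psi> I\<^sub>1 (subsample Z I\<^sub>1 \<omega>) (shift_n d \<theta>\<^sub>0 \<delta> \<eta>) j
                   - mean_psi P \<psi> (shift_n d \<theta>\<^sub>0 \<delta> \<eta>) j
                   - avg_psi \<psi> I\<^sub>1 (subsample Z I\<^sub>1 \<omega>) \<theta>\<^sub>0 j)))
              \<ge> ereal (u \<delta> \<epsilon>)}
         \<le> ennreal \<epsilon>"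
    and eps: "\<epsilon> \<in> {0<..<1}" and r: "r \<in> {0<..<\<delta>\<^sub>0}"
    and radius: "ereal (\<mu>low r) >
           ereal (u r \<epsilon> / sqrt (real n / 2)) +
           ereal (2 * (22 + 4 * q * exp q) / sqrt lam * lam) *
             (ereal (sqrt ((real d + ln (2 / \<epsilon>)) / real n)) +
              L_ratio d P \<psi> \<theta>\<^sub>0 q * ereal (sqrt (real d)) /
                ereal (real n powr (1 - 1 / q) * \<epsilon> powr (1 / q)))"
  interpret split_Z_estimation d n P \<Theta> \<psi> \<theta>\<^sub>0 M Z I\<^sub>1 I\<^sub>2 T by (rule est)
  show "measure M {\<omega> \<in> space M. dist_n d (T (subsample Z I\<^sub>1 \<omega>)) \<theta>\<^sub>0 > r} \<le> 2 * \<epsilon>"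
  proof (rule estimator_tail[OF lam assms(2,1) convex _ _ _ _ _ _ radius])
    show "\<mu>low r \<le> inner_n d \<eta> (mean_psi P \<psi> (shift_n d \<theta>\<^sub>0 r \<eta>))" if "\<eta> \<in> sphere_n d" for \<eta>
      using \<mu> r that by (auto simp: le_INF_iff)
  qed (use ray process eps r in auto)
qed

end
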